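(* Let $G$ be a finite expanded cactus with origin vertex $o$, let $\chi$ be a configuration on $G$, and let $C$ be a cluster of $G$ containing the origin cell. Then the following are equivalent: (i) $\chi$ is recurrent and adding a grain to the origin vertex $o$ causes exactly the cells in $C$ to topple in the first wave; (ii) $\chi$ satisfies the extended filling rules with respect to $C$ and satisfies the liberty rule with respect to $C$.
   Context: Expanded cactus: $\Gamma$ is obtained from the infinite $3$-regular tree by replacing each vertex by a $3$-cycle (a cell), the three tree edges at that vertex becoming incident to the three different vertices of the cell; $\Gamma$ is $3$-regular. A finite expanded cactus $G$ is a connected finite induced subgraph of $\Gamma$ that is a union of cells; it has a designated origin vertex $o$, whose cell is the origin cell. A cluster is a nonempty connected subgraph that is a union of cells; clusters considered contain the origin cell. A decorated rooted subtree is a connected finite union of cells with a designated root vertex whose unique $\Gamma$-neighbor outside its own cell is not in the subgraph. Sandpile model on $G$ (or on a decorated rooted subtree): a configuration is a function $\chi:V(G)\to\{1,2,3\}$. Toppling a vertex $v$ of height $>3$ lowers its height by $3$ and raises by $1$ the height of each neighbor of $v$ in $G$ (other grains are lost). Adding a grain at $v$ raises its height by $1$; then vertices of height $>3$ are toppled until all heights are $\le 3$ (the avalanche; it terminates and which vertices topple does not depend on the order). A toppling sequence is a sequence of vertices which can be toppled in this order, each having height $>3$ when toppled, and after which the configuration is stable. A vertex $v$ topples in the first wave of the avalanche caused by adding a grain at $o$ if there is a toppling sequence containing $v$ in which the terms up to and including the first occurrence of $v$ include $o$ exactly once. A cell topples in the first wave if at least one of its vertices does. A forbidden subconfiguration (FSC)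 of $\chi$ is a nonempty set $V'$ of vertices such that $\chi(v)\le$ (number of neighbors of $v$ in $V'$) for all $v\in V'$. A configuration is recurrent if it is a recurrent state of the Markov chain that adds grains at random vertices and relaxes; by a known theorem this is equivalent to having no FSC, which may be taken as the definition. Radicals: removing the vertices of $C$ leaves connected components, each a decorated rooted subtree $U$ whose root is its unique vertex adjacent to a vertex of $C$. The restriction $\chi|_U$ is called a radical (induced by $C$), attached to that vertex of $C$. If the $\Gamma$-neighbor outside its cell of a vertex of $C$ is not in $G$, the vertex is regarded as having the empty radical attached. A radical is allowed if it has no FSC. An allowed radical is strongly allowed if attaching one new vertex of height $1$ to its root by an edge creates no FSC, and weakly allowed otherwise. A stopper is an allowed radical whose root vertex has height $1$ or $2$. The empty radical is by definition strongly allowed and a stopper. Filling rules (for a decorated rooted subtree with root $r$ and a cluster $C$ in it containing the cell of $r$; here the root $r$ plays the role of origin vertex, and $r$ has no radical attached): in each cell the origin-facing vertex is the one closest to $r$. A cell of $C$ is internal, medial or terminal according to whether both, exactly one, or none of its two non-origin-facing vertices is adjacent to another cell of $C$; the non-origin-facing vertices not adjacent to another cell of $C$ carry a (possibly empty) attached radical. A configuration satisfies the filling rules with respect to $C$ if all radicals are allowed, every origin-facing vertex of a cell of $C$ has height $3$, and: - Internal cell: the two non-origin-facing heights are $3,3$ or $3,2$ (in either order). - Medial cell, with $a$ the non-origin-facing vertex adjacent to another cell of $C$ and $b$ the one carrying a radical: $(\chi(a),\chi(b))$ is $(3,3)$, $(3,2)$ or $(2,3)$ and the radical is a stopper; or it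 is $(3,1)$ and the radical is strongly allowed. - Terminal cell: the two non-origin-facing heights are (in either order) $3,3$ or $3,2$, with both radicals stoppers; or $3,1$, with the radical at the height-$3$ vertex a stopper and the radical at the height-$1$ vertex strongly allowed; or $2,2$, with at least one of the two radicals strongly allowed and the other allowed; or $2,1$, with both radicals strongly allowed. Extended filling rules: let $o'$ be the $\Gamma$-neighbor of $o$ outside the origin cell. Cutting the edge $oo'$ divides $G$ into decorated rooted subtrees $U_1$ (root $o$) and $U_2$ (root $o'$; empty if $o'\notin G$); put $\chi_1=\chi|_{U_1}$, $\chi_2=\chi|_{U_2}$. Then $\chi$ satisfies the extended filling rules with respect to $C$ if either (1) $C$ does not contain the cell of $o'$, $\chi_1$ satisfies the filling rules with respect to $C$, and $\chi_2$ is a stopper; or (2) $C$ contains the cell of $o'$, $\chi_1$ satisfies the filling rules with respect to $C\cap U_1$ and $\chi_2$ satisfies the filling rules with respect to $C\cap U_2$. Liberty rule: a liberty of $\chi$ (with respect to $C$) is a radical induced by $C$ (possibly empty) attached to a vertex $v$ of $C$ such that there is a path from $v$ to $o$ all of whose vertices, including $v$ and $o$, have height $3$ (the path may be the single vertex $o$). $\chi$ satisfies the liberty rule with respect to $C$ if at least one liberty is strongly allowed. *)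

theory Defs
  imports Main
begin

text \<open>
  A graph is given by a symmetric adjacency predicate on a type of vertices; its induced
  subgraphs are given by their vertex sets.
\<close>

definition adj_on :: "('v \<Rightarrow> 'v \<Rightarrow> bool) \<Rightarrow> 'v set \<Rightarrow> 'v \<Rightarrow> 'v \<Rightarrow> bool" where
  "adj_on E S x y \<longleftrightarrow> x \<in> S \<and> y \<in> S \<and> E x y"

text \<open>The connected component of \<open>x\<close> in the subgraph induced on \<open>S\<close>; empty if \<open>x \<notin> S\<close>.\<close>

definition component :: "('v \<Rightarrow> 'v \<Rightarrow> bool) \<Rightarrow> 'v set \<Rightarrow> 'v \<Rightarrow> 'v set" where
  "component E S x = {y. x \<in> S \<and> (adj_on E S)\<^sup>*\<^sup>* x y}"

definition connected_in :: "('v \<Rightarrow> 'v \<Rightarrow> bool) \<Rightarrow> 'v set \<Rightarrow> bool" where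
  "connected_in E S \<longleftrightarrow> (\<forall>x\<in>S. \<forall>y\<in>S. y \<in> component E S x)"

definition graph_dist :: "('v \<Rightarrow> 'v \<Rightarrow> bool) \<Rightarrow> 'v set \<Rightarrow> 'v \<Rightarrow> 'v \<Rightarrow> nat" where
  "graph_dist E S x y = (LEAST n. (adj_on E S ^^ n) x y)"

definition acyclic_graph :: "('v \<Rightarrow> 'v \<Rightarrow> bool) \<Rightarrow> bool" where
  "acyclic_graph E \<longleftrightarrow>
     \<not> (\<exists>p. length p \<ge> 3 \<and> distinct p \<and> successively E p \<and> E (last p) (hd p))"

text \<open>The whole type is the vertex set; such a tree is automatically infinite.\<close>

definition three_regular_tree :: "('a \<Rightarrow> 'a \<Rightarrow> bool) \<Rightarrow> bool" where
  "three_regular_tree T \<longleftrightarrow> symp T \<and> irreflp T \<and> connected_in T UNIV \<and> acyclic_graph T \<and>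
     (\<forall>s. card {t. T s t} = 3)"


subsection \<open>The infinite expanded cactus\<close>

text \<open>
  For the infinite 3-regular tree \<open>T\<close>, the vertices of the infinite expanded cactus are the pairs
  \<open>(s, t)\<close> with \<open>s\<close> and \<open>t\<close> adjacent in \<open>T\<close>: \<open>(s, t)\<close> is the vertex of the 3-cycle replacing
  \<open>s\<close> to which the tree edge between \<open>s\<close> and \<open>t\<close> has become incident. That edge now joins
  \<open>(s, t)\<close> to \<open>(t, s)\<close>.
\<close>

definition cactus_cell :: "('a \<Rightarrow> 'a \<Rightarrow> bool) \<Rightarrow> 'a \<Rightarrow> ('a \<times> 'a) set" where
  "cactus_cell T s = {(s, t) | t. T s t}"

text \<open>The unique neighbor of a vertex outside its own cell.\<close>

definition outer :: "'a \<times> 'a \<Rightarrow> 'a \<times> 'a" where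
  "outer v = (snd v, fst v)"

definition cactus_adj :: "('a \<Rightarrow> 'a \<Rightarrow> bool) \<Rightarrow> 'a \<times> 'a \<Rightarrow> 'a \<times> 'a \<Rightarrow> bool" where
  "cactus_adj T v w \<longleftrightarrow> T (fst v) (snd v) \<and> T (fst w) (snd w) \<and>
     (fst v = fst w \<and> v \<noteq> w \<or> w = outer v)"

definition cells :: "('a \<Rightarrow> 'a \<Rightarrow> bool) \<Rightarrow> ('a \<times> 'a) set \<Rightarrow> ('a \<times> 'a) set set" where
  "cells T X = {K. K \<subseteq> X \<and> (\<exists>s. K = cactus_cell T s)}"

definition cell_of :: "('a \<Rightarrow> 'a \<Rightarrow> bool) \<Rightarrow> 'a \<times> 'a \<Rightarrow> ('a \<times> 'a) set" where
  "cell_of T v = cactus_cell T (fst v)"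

definition union_of_cells :: "('a \<Rightarrow> 'a \<Rightarrow> bool) \<Rightarrow> ('a \<times> 'a) set \<Rightarrow> bool" where
  "union_of_cells T X \<longleftrightarrow> (\<exists>A. X = (\<Union>s\<in>A. cactus_cell T s))"

definition finite_expanded_cactus :: "('a \<Rightarrow> 'a \<Rightarrow> bool) \<Rightarrow> ('a \<times> 'a) set \<Rightarrow> bool" where
  "finite_expanded_cactus T G \<longleftrightarrow>
     finite G \<and> G \<noteq> {} \<and> connected_in (cactus_adj T) G \<and> union_of_cells T G"

text \<open>
  A connected subgraph that is a union of cells contains every edge joining two of its cells
  (each such edge is a bridge), so it is induced and is given by its vertex set.
\<close>

definition cluster :: "('a \<Rightarrow> 'a \<Rightarrow> bool) \<Rightarrow> ('a \<times> 'a) set \<Rightarrow> ('a \<times> 'a) set \<Rightarrow> bool" where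
  "cluster T G C \<longleftrightarrow>
     C \<subseteq> G \<and> C \<noteq> {} \<and> connected_in (cactus_adj T) C \<and> union_of_cells T C"


subsection \<open>Sandpiles\<close>

text \<open>Only the heights on \<open>G\<close> matter; a height function may be arbitrary elsewhere.\<close>

definition configuration :: "'v set \<Rightarrow> ('v \<Rightarrow> nat) \<Rightarrow> bool" where
  "configuration G h \<longleftrightarrow> (\<forall>v\<in>G. h v \<in> {1, 2, 3})"

definition topple ::
  "('v \<Rightarrow> 'v \<Rightarrow> bool) \<Rightarrow> 'v set \<Rightarrow> 'v \<Rightarrow> ('v \<Rightarrow> nat) \<Rightarrow> 'v \<Rightarrow> nat" where
  "topple E G v h = (\<lambda>w. if w = v then h w - 3 else if adj_on E G v w then h w + 1 else h w)"

fun toppling_sequence ::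
  "('v \<Rightarrow> 'v \<Rightarrow> bool) \<Rightarrow> 'v set \<Rightarrow> ('v \<Rightarrow> nat) \<Rightarrow> 'v list \<Rightarrow> bool" where
  "toppling_sequence E G h [] \<longleftrightarrow> (\<forall>v\<in>G. h v \<le> 3)"
| "toppling_sequence E G h (v # vs) \<longleftrightarrow>
     v \<in> G \<and> h v > 3 \<and> toppling_sequence E G (topple E G v h) vs"

definition add_grain :: "'v \<Rightarrow> ('v \<Rightarrow> nat) \<Rightarrow> 'v \<Rightarrow> nat" where
  "add_grain v h = h(v := h v + 1)"

definition topples_in_first_wave ::
  "('v \<Rightarrow> 'v \<Rightarrow> bool) \<Rightarrow> 'v set \<Rightarrow> ('v \<Rightarrow> nat) \<Rightarrow> 'v \<Rightarrow> 'v \<Rightarrow> bool" where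
  "topples_in_first_wave E G h orig v \<longleftrightarrow>
     (\<exists>xs ys. toppling_sequence E G (add_grain orig h) (xs @ v # ys) \<and>
        v \<notin> set xs \<and> count_list (xs @ [v]) orig = 1)"

definition cell_topples_in_first_wave ::
  "('v \<Rightarrow> 'v \<Rightarrow> bool) \<Rightarrow> 'v set \<Rightarrow> ('v \<Rightarrow> nat) \<Rightarrow> 'v \<Rightarrow> 'v set \<Rightarrow> bool" where
  "cell_topples_in_first_wave E G h orig K \<longleftrightarrow> (\<exists>v\<in>K. topples_in_first_wave E G h orig v)"

definition forbidden_subconfiguration ::
  "('v \<Rightarrow> 'v \<Rightarrow> bool) \<Rightarrow> ('v \<Rightarrow> nat) \<Rightarrow> 'v set \<Rightarrow> bool" where
  "forbidden_subconfiguration E h V' \<longleftrightarrow>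
     V' \<noteq> {} \<and> (\<forall>v\<in>V'. h v \<le> card {w \<in> V'. E v w})"

definition has_FSC :: "('v \<Rightarrow> 'v \<Rightarrow> bool) \<Rightarrow> 'v set \<Rightarrow> ('v \<Rightarrow> nat) \<Rightarrow> bool" where
  "has_FSC E G h \<longleftrightarrow> (\<exists>V'\<subseteq>G. forbidden_subconfiguration E h V')"

text \<open>By a known theorem this is equivalent to recurrence for the sandpile Markov chain.\<close>

definition recurrent :: "('v \<Rightarrow> 'v \<Rightarrow> bool) \<Rightarrow> 'v set \<Rightarrow> ('v \<Rightarrow> nat) \<Rightarrow> bool" where
  "recurrent E G h \<longleftrightarrow> \<not> has_FSC E G h"


subsection \<open>Radicals\<close>

text \<open>
  A radical is given by the height function, its vertex set \<open>U\<close> and its root \<open>r\<close>; the empty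
  radical has \<open>U = {}\<close>, and then \<open>r\<close> is irrelevant. The new vertex attached to the root is \<open>None\<close>.
\<close>

definition allowed :: "('v \<Rightarrow> 'v \<Rightarrow> bool) \<Rightarrow> ('v \<Rightarrow> nat) \<Rightarrow> 'v set \<Rightarrow> bool" where
  "allowed E h U \<longleftrightarrow> \<not> has_FSC E U h"

fun attach_adj :: "('v \<Rightarrow> 'v \<Rightarrow> bool) \<Rightarrow> 'v \<Rightarrow> 'v option \<Rightarrow> 'v option \<Rightarrow> bool" where
  "attach_adj E r (Some x) (Some y) \<longleftrightarrow> E x y"
| "attach_adj E r (Some x) None \<longleftrightarrow> x = r"
| "attach_adj E r None (Some y) \<longleftrightarrow> y = r"
| "attach_adj E r None None \<longleftrightarrow> False"

definition strongly_allowed ::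
  "('v \<Rightarrow> 'v \<Rightarrow> bool) \<Rightarrow> ('v \<Rightarrow> nat) \<Rightarrow> 'v set \<Rightarrow> 'v \<Rightarrow> bool" where
  "strongly_allowed E h U r \<longleftrightarrow> U = {} \<or>
     allowed E h U \<and> \<not> has_FSC (attach_adj E r) (insert None (Some ` U)) (case_option 1 h)"

definition stopper :: "('v \<Rightarrow> 'v \<Rightarrow> bool) \<Rightarrow> ('v \<Rightarrow> nat) \<Rightarrow> 'v set \<Rightarrow> 'v \<Rightarrow> bool" where
  "stopper E h U r \<longleftrightarrow> U = {} \<or> allowed E h U \<and> h r \<in> {1, 2}"

text \<open>
  The vertex set of the radical attached to \<open>v \<in> C\<close> within \<open>G\<close>, when \<open>outer v \<notin> C\<close>; its root is
  \<open>outer v\<close>, and it is empty iff \<open>outer v \<notin> G\<close>.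
\<close>

definition radical ::
  "('a \<Rightarrow> 'a \<Rightarrow> bool) \<Rightarrow> ('a \<times> 'a) set \<Rightarrow> ('a \<times> 'a) set \<Rightarrow> 'a \<times> 'a \<Rightarrow> ('a \<times> 'a) set" where
  "radical T G C v = component (cactus_adj T) (G - C) (outer v)"

definition radical_allowed ::
  "('a \<Rightarrow> 'a \<Rightarrow> bool) \<Rightarrow> ('a \<times> 'a) set \<Rightarrow> ('a \<times> 'a) set \<Rightarrow> ('a \<times> 'a \<Rightarrow> nat) \<Rightarrow> 'a \<times> 'a \<Rightarrow> bool" where
  "radical_allowed T G C h v \<longleftrightarrow> allowed (cactus_adj T) h (radical T G C v)"

definition radical_strongly_allowed ::
  "('a \<Rightarrow> 'a \<Rightarrow> bool) \<Rightarrow> ('a \<times> 'a) set \<Rightarrow> ('a \<times> 'a) set \<Rightarrow> ('a \<times> 'a \<Rightarrow> nat) \<Rightarrow> 'a \<times> 'a \<Rightarrow> bool" where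
  "radical_strongly_allowed T G C h v \<longleftrightarrow>
     strongly_allowed (cactus_adj T) h (radical T G C v) (outer v)"

definition radical_stopper ::
  "('a \<Rightarrow> 'a \<Rightarrow> bool) \<Rightarrow> ('a \<times> 'a) set \<Rightarrow> ('a \<times> 'a) set \<Rightarrow> ('a \<times> 'a \<Rightarrow> nat) \<Rightarrow> 'a \<times> 'a \<Rightarrow> bool" where
  "radical_stopper T G C h v \<longleftrightarrow> stopper (cactus_adj T) h (radical T G C v) (outer v)"


subsection \<open>Filling rules and liberty rule\<close>

definition adj_other_cell ::
  "('a \<Rightarrow> 'a \<Rightarrow> bool) \<Rightarrow> ('a \<times> 'a) set \<Rightarrow> ('a \<times> 'a) set \<Rightarrow> 'a \<times> 'a \<Rightarrow> bool" where
  "adj_other_cell T C K v \<longleftrightarrow> (\<exists>K'\<in>cells T C. K' \<noteq> K \<and> (\<exists>w\<in>K'. cactus_adj T v w))"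

definition origin_facing ::
  "('a \<Rightarrow> 'a \<Rightarrow> bool) \<Rightarrow> ('a \<times> 'a) set \<Rightarrow> 'a \<times> 'a \<Rightarrow> ('a \<times> 'a) set \<Rightarrow> 'a \<times> 'a \<Rightarrow> bool" where
  "origin_facing T U r K x \<longleftrightarrow> is_arg_min (graph_dist (cactus_adj T) U r) (\<lambda>v. v \<in> K) x"

definition internal_rule :: "('v \<Rightarrow> nat) \<Rightarrow> 'v \<Rightarrow> 'v \<Rightarrow> bool" where
  "internal_rule h a b \<longleftrightarrow> (h a, h b) \<in> {(3, 3), (3, 2), (2, 3)}"

text \<open>Here \<open>a\<close> is the vertex adjacent to another cell of \<open>C\<close> and \<open>b\<close> carries a radical.\<close>

definition medial_rule ::
  "('a \<Rightarrow> 'a \<Rightarrow> bool) \<Rightarrow> ('a \<times> 'a) set \<Rightarrow> ('a \<times> 'a) set \<Rightarrow> ('a \<times> 'a \<Rightarrow> nat) \<Rightarrow>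
     'a \<times> 'a \<Rightarrow> 'a \<times> 'a \<Rightarrow> bool" where
  "medial_rule T U C h a b \<longleftrightarrow>
     (h a, h b) \<in> {(3, 3), (3, 2), (2, 3)} \<and> radical_stopper T U C h b \<or>
     (h a, h b) = (3, 1) \<and> radical_strongly_allowed T U C h b"

definition ordered_terminal_rule ::
  "('a \<Rightarrow> 'a \<Rightarrow> bool) \<Rightarrow> ('a \<times> 'a) set \<Rightarrow> ('a \<times> 'a) set \<Rightarrow> ('a \<times> 'a \<Rightarrow> nat) \<Rightarrow>
     'a \<times> 'a \<Rightarrow> 'a \<times> 'a \<Rightarrow> bool" where
  "ordered_terminal_rule T U C h a b \<longleftrightarrow>
     (h a, h b) \<in> {(3, 3), (3, 2)} \<and> radical_stopper T U C h a \<and> radical_stopper T U C h b \<or>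
     (h a, h b) = (3, 1) \<and> radical_stopper T U C h a \<and> radical_strongly_allowed T U C h b \<or>
     (h a, h b) = (2, 2) \<and> radical_strongly_allowed T U C h a \<and> radical_allowed T U C h b \<or>
     (h a, h b) = (2, 1) \<and> radical_strongly_allowed T U C h a \<and> radical_strongly_allowed T U C h b"

definition terminal_rule ::
  "('a \<Rightarrow> 'a \<Rightarrow> bool) \<Rightarrow> ('a \<times> 'a) set \<Rightarrow> ('a \<times> 'a) set \<Rightarrow> ('a \<times> 'a \<Rightarrow> nat) \<Rightarrow>
     'a \<times> 'a \<Rightarrow> 'a \<times> 'a \<Rightarrow> bool" where
  "terminal_rule T U C h a b \<longleftrightarrow>
     ordered_terminal_rule T U C h a b \<or> ordered_terminal_rule T U C h b a"

text \<open>
  The filling rules for the decorated rooted subtree \<open>U\<close> with root \<open>r\<close>. The two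
  non-origin-facing vertices \<open>a, b\<close> of a cell are quantified in both orders, so the clause with
  only \<open>a\<close> adjacent to another cell covers all medial cells.
\<close>

definition filling_rules ::
  "('a \<Rightarrow> 'a \<Rightarrow> bool) \<Rightarrow> ('a \<times> 'a) set \<Rightarrow> 'a \<times> 'a \<Rightarrow> ('a \<times> 'a) set \<Rightarrow>
     ('a \<times> 'a \<Rightarrow> nat) \<Rightarrow> bool" where
  "filling_rules T U r C h \<longleftrightarrow>
     (\<forall>v\<in>C. v \<noteq> r \<and> outer v \<notin> C \<longrightarrow> radical_allowed T U C h v) \<and>
     (\<forall>K\<in>cells T C. \<forall>x a b. K = {x, a, b} \<and> distinct [x, a, b] \<and> origin_facing T U r K x \<longrightarrow>
        h x = 3 \<and>
        (adj_other_cell T C K a \<and> adj_other_cell T C K b \<longrightarrow> internal_rule h a b) \<and>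
        (adj_other_cell T C K a \<and> \<not> adj_other_cell T C K b \<longrightarrow> medial_rule T U C h a b) \<and>
        (\<not> adj_other_cell T C K a \<and> \<not> adj_other_cell T C K b \<longrightarrow> terminal_rule T U C h a b))"

definition cut_adj :: "('v \<Rightarrow> 'v \<Rightarrow> bool) \<Rightarrow> 'v \<Rightarrow> 'v \<Rightarrow> 'v \<Rightarrow> 'v \<Rightarrow> bool" where
  "cut_adj E x y v w \<longleftrightarrow> E v w \<and> {v, w} \<noteq> {x, y}"

definition extended_filling_rules ::
  "('a \<Rightarrow> 'a \<Rightarrow> bool) \<Rightarrow> ('a \<times> 'a) set \<Rightarrow> 'a \<times> 'a \<Rightarrow> ('a \<times> 'a) set \<Rightarrow>
     ('a \<times> 'a \<Rightarrow> nat) \<Rightarrow> bool" where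
  "extended_filling_rules T G orig C h \<longleftrightarrow>
     (let orig' = outer orig;
          U1 = component (cut_adj (cactus_adj T) orig orig') G orig;
          U2 = component (cut_adj (cactus_adj T) orig orig') G orig'
      in (\<not> cell_of T orig' \<subseteq> C \<and> filling_rules T U1 orig C h \<and> stopper (cactus_adj T) h U2 orig') \<or>
         (cell_of T orig' \<subseteq> C \<and> filling_rules T U1 orig (C \<inter> U1) h \<and>
            filling_rules T U2 orig' (C \<inter> U2) h))"

text \<open>A liberty is identified by the vertex \<open>v\<close> of \<open>C\<close> to which it is attached.\<close>

definition liberty ::
  "('a \<Rightarrow> 'a \<Rightarrow> bool) \<Rightarrow> ('a \<times> 'a) set \<Rightarrow> 'a \<times> 'a \<Rightarrow> ('a \<times> 'a) set \<Rightarrow>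
     ('a \<times> 'a \<Rightarrow> nat) \<Rightarrow> 'a \<times> 'a \<Rightarrow> bool" where
  "liberty T G orig C h v \<longleftrightarrow> v \<in> C \<and> outer v \<notin> C \<and>
     orig \<in> component (cactus_adj T) {w \<in> G. h w = 3} v"

definition liberty_rule ::
  "('a \<Rightarrow> 'a \<Rightarrow> bool) \<Rightarrow> ('a \<times> 'a) set \<Rightarrow> 'a \<times> 'a \<Rightarrow> ('a \<times> 'a) set \<Rightarrow>
     ('a \<times> 'a \<Rightarrow> nat) \<Rightarrow> bool" where
  "liberty_rule T G orig C h \<longleftrightarrow>
     (\<exists>v. liberty T G orig C h v \<and> radical_strongly_allowed T G C h v)"

end

theory Submission
  imports Defs
begin

text \<open>
  The first wave topples the least set of vertices that contains the origin (which must have height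
  3) and every \<open>v\<close> for which the height plus the number of toppling neighbors exceeds 3. Every
  edge between two cells is a bridge, so the wave enters a cell through its origin-facing vertex,
  here called its gate; hence the heights of a cell decide which of its vertices topple, and a radical
  attached to a toppling vertex stays untouched exactly if it is a stopper.

  Recurrence enters through one principle: a weakly allowed radical contains a set that, joined to
  its attachment vertex, acts like a neighbor that never burns. If \<open>\<chi>\<close> is recurrent, every nonempty
  \<open>X \<subseteq> C\<close> therefore has a vertex whose height exceeds its number of neighbors in \<open>X\<close>, where a weakly
  allowed radical counts as a further neighbor. Sets of one or two vertices of a cell give the filling
  rules, and the union of the cells reached from the origin along vertices of height 3 gives a
  strongly allowed liberty. Conversely, a forbidden subconfiguration avoids the root of that
  liberty, hence the path of height 3 and the origin, hence by the filling rules cell by cell the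
  whole of \<open>C\<close>, and finally all the radicals.
\<close>


subsection \<open>First waves on dissipative graphs\<close>

text \<open>A toppling sequence without the demand of final stability, so that prefixes of toppling
  sequences can be treated on their own.\<close>

fun fireable ::
  "('v \<Rightarrow> 'v \<Rightarrow> bool) \<Rightarrow> 'v set \<Rightarrow> ('v \<Rightarrow> nat) \<Rightarrow> 'v list \<Rightarrow> bool" where
  "fireable E G h [] \<longleftrightarrow> True"
| "fireable E G h (v # vs) \<longleftrightarrow> v \<in> G \<and> h v > 3 \<and> fireable E G (topple E G v h) vs"

lemma fireable_append:
  "fireable E G h (xs @ ys) \<longleftrightarrow> fireable E G h xs \<and> fireable E G (fold (topple E G) xs h) ys"
  by (induction xs arbitrary: h) auto

lemma toppling_sequence_append:
  "toppling_sequence E G h (xs @ ys) \<longleftrightarrow>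
     fireable E G h xs \<and> toppling_sequence E G (fold (topple E G) xs h) ys"
  by (induction xs arbitrary: h) auto

lemma fireable_subset: "fireable E G h xs \<Longrightarrow> set xs \<subseteq> G"
  by (induction xs arbitrary: h) auto

text \<open>By the degree bound a toppling never creates grains, and by \<open>dissipative\<close>
  every nonempty set contains a vertex whose toppling removes a grain from the set. On a finite
  graph this makes stabilization possible.\<close>

locale dissipative_graph =
  fixes E :: "'v \<Rightarrow> 'v \<Rightarrow> bool" and G :: "'v set"
  assumes finite_G: "finite G"
    and E_sym: "E v w \<Longrightarrow> E w v"
    and E_irrefl: "\<not> E v v"
    and degree: "v \<in> G \<Longrightarrow> finite {w. E v w} \<and> card {w. E v w} \<le> 3"
    and dissipative: "S \<subseteq> G \<Longrightarrow> S \<noteq> {} \<Longrightarrow> \<exists>v\<in>S. card {w \<in> S. E v w} < 3"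
begin

text \<open>The vertex gives up three grains, and one comes back to \<open>S\<close> for each
  neighbor inside \<open>S\<close>. Additions on both sides avoid truncated subtraction.\<close>

lemma sum_topple:
  assumes "S \<subseteq> G" "v \<in> S" "h v > 3"
  shows "sum (topple E G v h) S + 3 = sum h S + card {w \<in> S. E v w}"
proof -
  have fin: "finite S" using assms finite_G finite_subset by blast
  have "sum (topple E G v h) S = topple E G v h v + sum (topple E G v h) (S - {v})"
    using fin assms by (simp add: sum.remove)
  also have "sum (topple E G v h) (S - {v}) =
      sum (\<lambda>w. h w + (if E v w then 1 else 0)) (S - {v})"
    using assms by (intro sum.cong) (auto simp: topple_def adj_on_def)
  also have "\<dots> = sum h (S - {v}) + card ({w \<in> S - {v}. E v w})"
    using fin by (simp add: sum.distrib sum.If_cases Int_def)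
  also have "{w \<in> S - {v}. E v w} = {w \<in> S. E v w}"
    using E_irrefl by auto
  finally have "sum (topple E G v h) S =
      topple E G v h v + (sum h (S - {v}) + card {w \<in> S. E v w})" .
  moreover have "sum h S = h v + sum h (S - {v})"
    using fin assms by (simp add: sum.remove)
  moreover have "topple E G v h v + 3 = h v"
    using assms by (simp add: topple_def)
  ultimately show ?thesis by simp
qed

lemma sum_fold_topple_le:
  assumes "S \<subseteq> G" "set xs \<subseteq> S" "fireable E G h xs"
  shows "sum (fold (topple E G) xs h) S \<le> sum h S"
  using assms
proof (induction xs arbitrary: h)
  case (Cons v xs)
  have "card {w \<in> S. E v w} \<le> 3"
  proof -
    have "v \<in> G" using Cons.prems by auto
    then have "card {w \<in> S. E v w} \<le> card {w. E v w}"
      using degree by (intro card_mono) auto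
    then show ?thesis using degree \<open>v \<in> G\<close> le_trans by blast
  qed
  moreover have "sum (topple E G v h) S + 3 = sum h S + card {w \<in> S. E v w}"
    using Cons.prems by (intro sum_topple) auto
  moreover have "sum (fold (topple E G) xs (topple E G v h)) S \<le> sum (topple E G v h) S"
    using Cons by auto
  ultimately show ?case by simp
qed simp

text \<open>
  A vertex with a neighbor outside \<open>S\<close> is toppled only after the rest of \<open>S\<close> has been
  stabilized; each of its topplings removes a grain from \<open>S\<close>.
\<close>

lemma stabilize_on:
  assumes "S \<subseteq> G"
  shows "\<exists>xs. set xs \<subseteq> S \<and> fireable E G h xs \<and> (\<forall>v\<in>S. fold (topple E G) xs h v \<le> 3)"
proof -
  have "finite S" using assms finite_G finite_subset by blast
  then show ?thesis using assms
  proof (induction S arbitrary: h rule: finite_psubset_induct)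
    case (psubset S)
    show ?case
    proof (cases "S = {}")
      case True
      then show ?thesis by (intro exI[of _ "[]"]) auto
    next
      case False
      obtain v where v: "v \<in> S" "card {w \<in> S. E v w} < 3"
        using dissipative[OF psubset.prems False] by blast
      show ?thesis
      proof (induction "sum h S" arbitrary: h rule: less_induct)
        case less
        have "S - {v} \<subset> S" using v by auto
        then obtain xs where xs: "set xs \<subseteq> S - {v}" "fireable E G h xs"
          "\<forall>w\<in>S - {v}. fold (topple E G) xs h w \<le> 3"
          using psubset.IH psubset.prems by (meson Diff_subset subset_trans)
        let ?h = "fold (topple E G) xs h"
        show ?case
        proof (cases "?h v \<le> 3")
          case True
          then show ?thesis using xs by (intro exI[of _ xs]) auto
        next
          case False
          let ?h' = "topple E G v ?h"
          have "sum ?h' S + 3 = sum ?h S + card {w \<in> S. E v w}"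
            using sum_topple[of S v ?h] False v psubset.prems by auto
          moreover have "sum ?h S \<le> sum h S"
            using sum_fold_topple_le[of S xs h] xs psubset.prems by auto
          ultimately have "sum ?h' S < sum h S" using v by linarith
          then obtain ys where ys: "set ys \<subseteq> S" "fireable E G ?h' ys"
            "\<forall>w\<in>S. fold (topple E G) ys ?h' w \<le> 3"
            using less by blast
          show ?thesis
            using xs ys v False psubset.prems
            by (intro exI[of _ "xs @ v # ys"]) (auto simp: fireable_append)
        qed
      qed
    qed
  qed
qed

text \<open>Completes partial runs: membership in the first wave is defined by full toppling
  sequences.\<close>

lemma stabilize: "\<exists>xs. toppling_sequence E G h xs"
proof -
  obtain xs where "fireable E G h xs" "\<forall>v\<in>G. fold (topple E G) xs h v \<le> 3"
    using stabilize_on[of G h] by auto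
  then have "toppling_sequence E G h (xs @ [])"
    unfolding toppling_sequence_append by simp
  then show ?thesis by blast
qed

text \<open>Each vertex of \<open>xs\<close> topples once, so \<open>w\<close> gains one grain per
  toppled neighbor and loses three if it topples itself.\<close>

lemma height_after_distinct:
  assumes "fireable E G h xs" "distinct xs" "w \<in> G"
  shows "fold (topple E G) xs h w + (if w \<in> set xs then 3 else 0) =
    h w + card {u \<in> set xs. E w u}"
  using assms
proof (induction xs rule: rev_induct)
  case (snoc v xs)
  let ?h = "fold (topple E G) xs h"
  have IH: "?h w + (if w \<in> set xs then 3 else 0) = h w + card {u \<in> set xs. E w u}"
    using snoc by (auto simp: fireable_append)
  have v: "v \<in> G" "?h v > 3" "v \<notin> set xs"
    using snoc by (auto simp: fireable_append)
  have set_eq: "{u \<in> set (xs @ [v]). E w u} =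
      (if E w v then insert v {u \<in> set xs. E w u} else {u \<in> set xs. E w u})"
    by auto
  have "fold (topple E G) (xs @ [v]) h w =
      (if w = v then ?h w - 3 else if E w v then ?h w + 1 else ?h w)"
    using v snoc.prems E_sym by (auto simp: topple_def[of _ _ _ ?h] adj_on_def)
  then show ?case
    unfolding set_eq using IH v snoc.prems E_irrefl by auto
qed simp

end

section \<open>The first wave as a least closed set\<close>

locale sandpile = dissipative_graph +
  fixes h :: "'a \<Rightarrow> nat" and orig :: 'a
  assumes config: "configuration G h"
    and orig_in: "orig \<in> G"
begin

definition first_wave :: "'a set" where
  "first_wave = {v. topples_in_first_wave E G h orig v}"

text \<open>No vertex outside \<open>S\<close> would be unstable after each vertex of
  \<open>S\<close> has toppled once. The added grain is left out; membership of the origin is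
  required separately.\<close>

definition wave_closed :: "'a set \<Rightarrow> bool" where
  "wave_closed S \<longleftrightarrow> (\<forall>v\<in>G. h v + card {w \<in> S. E v w} > 3 \<longrightarrow> v \<in> S)"

lemma h_bounds: "v \<in> G \<Longrightarrow> 1 \<le> h v \<and> h v \<le> 3"
  using config unfolding configuration_def by fastforce

lemma degree_Collect: "v \<in> G \<Longrightarrow> card {w \<in> S. E v w} \<le> 3"
proof -
  assume "v \<in> G"
  then have "card {w \<in> S. E v w} \<le> card {w. E v w}"
    using degree by (intro card_mono) auto
  then show ?thesis using degree \<open>v \<in> G\<close> le_trans by blast
qed

text \<open>Until the origin topples again, nothing topples twice: a toppled vertex other than the
  origin holds at most \<open>h v + 3 - 3\<close>, hence at most 3 grains. A vertex toppling for the
  first time lies in \<open>S\<close> because its toppled neighbors do.\<close>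

lemma wave_prefix:
  assumes "fireable E G (add_grain orig h) xs" "count_list xs orig \<le> 1"
    and "orig \<in> S" "wave_closed S"
  shows "distinct xs \<and> set xs \<subseteq> S"
  using assms
proof (induction xs rule: rev_induct)
  case (snoc v xs)
  let ?h = "fold (topple E G) xs (add_grain orig h)"
  have xs: "distinct xs" "set xs \<subseteq> S" "fireable E G (add_grain orig h) xs"
    using snoc by (auto simp: fireable_append)
  have v: "v \<in> G" "?h v > 3"
    using snoc by (auto simp: fireable_append)
  have ht: "?h v + (if v \<in> set xs then 3 else 0) =
      add_grain orig h v + card {u \<in> set xs. E v u}"
    using height_after_distinct xs v by blast
  have deg: "card {u \<in> set xs. E v u} \<le> 3" using degree_Collect v by blast
  show ?case
  proof (cases "v = orig")
    case True
    then have "v \<notin> set xs" using snoc.prems by (auto simp: count_list_0_iff)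
    then show ?thesis using xs True snoc.prems by simp
  next
    case False
    then have "v \<notin> set xs"
      using ht deg v h_bounds[of v] by (auto simp: add_grain_def)
    moreover have "v \<in> S"
    proof -
      have "card {u \<in> set xs. E v u} \<le> card {u \<in> S. E v u}"
        using xs degree[OF v(1)] by (intro card_mono) auto
      then have "h v + card {u \<in> S. E v u} > 3"
        using ht v False \<open>v \<notin> set xs\<close> by (auto simp: add_grain_def)
      then show ?thesis using v snoc.prems unfolding wave_closed_def by blast
    qed
    ultimately show ?thesis using xs by simp
  qed
qed simp

lemma first_wave_least:
  assumes "orig \<in> S" "wave_closed S"
  shows "first_wave \<subseteq> S"
proof
  fix v assume "v \<in> first_wave"
  then obtain xs ys where "toppling_sequence E G (add_grain orig h) ((xs @ [v]) @ ys)"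
    "count_list (xs @ [v]) orig = 1"
    unfolding first_wave_def topples_in_first_wave_def by auto
  then show "v \<in> S"
    using wave_prefix[of "xs @ [v]" S] assms unfolding toppling_sequence_append by auto
qed

text \<open>No height of a configuration exceeds 3, so the added grain makes at most the origin
  unstable, and only from height 3.\<close>

lemma fireable_hd:
  assumes "fireable E G (add_grain orig h) (v # xs)"
  shows "v = orig" "h orig = 3"
  using assms h_bounds[of v] h_bounds[of orig] orig_in
  by (auto simp: add_grain_def split: if_splits)

lemma first_wave_height_orig:
  assumes "first_wave \<noteq> {}"
  shows "h orig = 3"
proof -
  obtain v xs ys where "toppling_sequence E G (add_grain orig h) ((xs @ [v]) @ ys)"
    using assms unfolding first_wave_def topples_in_first_wave_def by auto
  then have "fireable E G (add_grain orig h) (xs @ [v])"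
    unfolding toppling_sequence_append by simp
  then show ?thesis using fireable_hd(2) by (metis append_is_Nil_conv list.exhaust not_Cons_self2)
qed

text \<open>
  A longest sequence without repetitions that can be fired consists of the vertices of the first
  wave.
\<close>

lemma first_wave_closure:
  assumes "h orig = 3"
  shows "orig \<in> first_wave \<and> wave_closed first_wave \<and> first_wave \<subseteq> G"
proof -
  let ?P = "\<lambda>xs. fireable E G (add_grain orig h) xs \<and> distinct xs"
  have P1: "?P [orig]" using assms orig_in by (simp add: add_grain_def)
  have bound: "length xs \<le> card G" if "?P xs" for xs
    using that fireable_subset[of E G _ xs] finite_G
    by (metis card_mono distinct_card)
  \<comment> \<open>A run without repetitions has at most \<open>card G\<close> terms, so a longest
    one exists.\<close>
  obtain L where L: "?P L" and max: "\<And>xs. ?P xs \<Longrightarrow> length xs \<le> length L"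
    using ex_has_greatest_nat[of ?P "[orig]" length "Suc (card G)"] P1 bound
    by (metis less_Suc_eq_le)
  have "L \<noteq> []" using max[OF P1] by auto
  have L_sub: "set L \<subseteq> first_wave"
  proof
    fix v assume "v \<in> set L"
    then obtain xs ys where L_eq: "L = xs @ v # ys" by (meson split_list)
    \<comment> \<open>Stabilizing after \<open>L\<close> supplies the complete toppling sequence
      that the definition of the first wave requires.\<close>
    obtain zs where "toppling_sequence E G (fold (topple E G) L (add_grain orig h)) zs"
      using stabilize by blast
    then have "toppling_sequence E G (add_grain orig h) (L @ zs)"
      using L unfolding toppling_sequence_append by blast
    then have ts: "toppling_sequence E G (add_grain orig h) (xs @ v # (ys @ zs))"
      unfolding L_eq by simp
    have "orig \<in> set (xs @ [v])"
      using L fireable_hd(1)[of "hd L" "tl L"] \<open>L \<noteq> []\<close> unfolding L_eq by (cases xs) auto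
    moreover have "distinct (xs @ [v])" using L unfolding L_eq by simp
    ultimately have "count_list (xs @ [v]) orig = 1"
      by (auto simp: count_list_0_iff dest!: split_list)
    then show "v \<in> first_wave"
      using ts L unfolding L_eq first_wave_def topples_in_first_wave_def by auto
  qed
  \<comment> \<open>A vertex violating closedness would be unstable after \<open>L\<close> and could
    be appended, against maximality.\<close>
  have closed: "wave_closed (set L)"
    unfolding wave_closed_def
  proof (intro ballI impI, rule ccontr)
    fix v assume v: "v \<in> G" "3 < h v + card {w \<in> set L. E v w}" "v \<notin> set L"
    have "fold (topple E G) L (add_grain orig h) v =
        add_grain orig h v + card {u \<in> set L. E v u}"
      using height_after_distinct[of "add_grain orig h" L v] L v by simp
    then have "?P (L @ [v])"
      using L v by (auto simp: fireable_append add_grain_def)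
    then show False using max by fastforce
  qed
  have orig_L: "orig \<in> set L"
    using L fireable_hd(1)[of "hd L" "tl L"] \<open>L \<noteq> []\<close> by (cases L) auto
  then have "first_wave = set L"
    using first_wave_least closed L_sub by blast
  then show ?thesis using closed orig_L L fireable_subset by metis
qed

lemma first_wave_subset: "first_wave \<subseteq> G"
  using first_wave_closure first_wave_height_orig by (cases "first_wave = {}") auto

lemma first_wave_closed:
  assumes "h orig = 3" "v \<in> G" "h v + card {w \<in> first_wave. E v w} > 3"
  shows "v \<in> first_wave"
  using first_wave_closure assms unfolding wave_closed_def by blast

lemma orig_in_first_wave: "h orig = 3 \<Longrightarrow> orig \<in> first_wave"
  using first_wave_closure by blast

text \<open>\<open>v\<close> plays the role of the first vertex of \<open>B\<close> to topple:
  contributions from outside \<open>B\<close> suffice for it. It exists because the wave without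
  \<open>B\<close> still contains the origin and hence, by leastness, is not closed.\<close>

lemma first_wave_entry:
  assumes "first_wave \<inter> B \<noteq> {}" "orig \<notin> B"
  obtains v where "v \<in> first_wave" "v \<in> B" "h v + card {w \<in> first_wave - B. E v w} > 3"
proof -
  have h: "h orig = 3" using first_wave_height_orig assms by blast
  have "\<not> first_wave \<subseteq> first_wave - B" using assms by blast
  then have "\<not> wave_closed (first_wave - B)"
    using first_wave_least[of "first_wave - B"] assms orig_in_first_wave[OF h] by blast
  then obtain v where v: "v \<in> G" "h v + card {w \<in> first_wave - B. E v w} > 3"
    "v \<notin> first_wave - B"
    unfolding wave_closed_def by blast
  have "card {w \<in> first_wave - B. E v w} \<le> card {w \<in> first_wave. E v w}"
    using degree[OF v(1)] by (intro card_mono) auto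
  then have "v \<in> first_wave" using v first_wave_closed[OF h] by simp
  then show ?thesis using v that by blast
qed

end


subsection \<open>The tree rooted at an edge\<close>

text \<open>If the next vertex already occurs on the path, the path is cut there instead of being
  extended.\<close>

lemma simple_path_exists:
  assumes "(adj_on E S)\<^sup>*\<^sup>* x y" "x \<in> S"
  shows "\<exists>q. q \<noteq> [] \<and> hd q = x \<and> last q = y \<and> distinct q \<and> successively E q \<and> set q \<subseteq> S"
  using assms
proof (induction rule: rtranclp_induct)
  case base
  then show ?case by (intro exI[of _ "[x]"]) auto
next
  case (step y z)
  then obtain q where q: "q \<noteq> []" "hd q = x" "last q = y" "distinct q" "successively E q"
    "set q \<subseteq> S" by blast
  show ?case
  proof (cases "z \<in> set q")
    case True
    then obtain q1 q2 where "q = q1 @ z # q2" by (meson split_list)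
    then have "q = (q1 @ [z]) @ q2" by simp
    then show ?thesis using q
      by (intro exI[of _ "q1 @ [z]"]) (auto simp: successively_append_iff hd_append)
  next
    case False
    then show ?thesis using q step.hyps(2)
      by (intro exI[of _ "q @ [z]"]) (auto simp: successively_append_iff adj_on_def)
  qed
qed

text \<open>A simple path from \<open>x\<close> to \<open>y\<close> avoiding \<open>z\<close> would
  close up through \<open>z\<close> to a cycle.\<close>

lemma acyclic_graph_no_detour:
  assumes "acyclic_graph E" "symp E" "E z x" "E z y" "x \<noteq> y" "x \<noteq> z"
    "(adj_on E (- {z}))\<^sup>*\<^sup>* x y"
  shows False
proof -
  obtain q where q: "q \<noteq> []" "hd q = x" "last q = y" "distinct q" "successively E q"
    "set q \<subseteq> - {z}"
    using simple_path_exists[OF assms(7)] assms(6) by auto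
  have "length q \<ge> 2"
    using q assms(5) by (cases q; cases "tl q") auto
  then have "length (z # q) \<ge> 3 \<and> distinct (z # q) \<and> successively E (z # q) \<and>
      E (last (z # q)) (hd (z # q))"
    using q assms by (auto simp: successively_Cons dest: sympD)
  then show False using assms(1) unfolding acyclic_graph_def by blast
qed

locale rooted_tree =
  fixes T :: "'a \<Rightarrow> 'a \<Rightarrow> bool" and s0 t0 :: 'a
  assumes tree: "three_regular_tree T"
    and root_edge: "T s0 t0"
begin

lemma T_sym: "T s t \<Longrightarrow> T t s"
  and T_irrefl: "\<not> T s s"
  and T_card: "card {t. T s t} = 3"
  and T_symp: "symp T"
  and T_acyclic: "acyclic_graph T"
  and T_connected: "(adj_on T UNIV)\<^sup>*\<^sup>* s t"
  using tree unfolding three_regular_tree_def connected_in_def component_def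
  by (auto dest: sympD irreflpD)

text \<open>The distance to the nearer end of the root edge. Both ends get depth 0, so the two
  halves of the tree are treated alike.\<close>

definition depth :: "'a \<Rightarrow> nat" where
  "depth s = (LEAST n. (T ^^ n) s0 s \<or> (T ^^ n) t0 s)"

lemma depth_exists: "\<exists>n. (T ^^ n) s0 s \<or> (T ^^ n) t0 s"
proof -
  have "adj_on T UNIV = T" by (intro ext) (simp add: adj_on_def)
  then have "T\<^sup>*\<^sup>* s0 s" using T_connected[of s0 s] by simp
  then show ?thesis using rtranclp_imp_relpowp by metis
qed

lemma depth_walk: "(T ^^ depth s) s0 s \<or> (T ^^ depth s) t0 s"
  unfolding depth_def by (rule LeastI_ex[OF depth_exists])

lemma depth_le: "(T ^^ n) s0 s \<or> (T ^^ n) t0 s \<Longrightarrow> depth s \<le> n"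
  unfolding depth_def by (rule Least_le)

lemma depth_eq_0_iff: "depth s = 0 \<longleftrightarrow> s = s0 \<or> s = t0"
proof
  show "depth s = 0 \<Longrightarrow> s = s0 \<or> s = t0" using depth_walk[of s] by auto
  show "s = s0 \<or> s = t0 \<Longrightarrow> depth s = 0" using depth_le[of 0 s] by auto
qed

lemma depth_Suc_parent:
  assumes "depth s = Suc n"
  obtains y where "T y s" "depth y \<le> n"
proof -
  have "(T ^^ Suc n) s0 s \<or> (T ^^ Suc n) t0 s" using depth_walk[of s] assms by simp
  then obtain y where "(T ^^ n) s0 y \<or> (T ^^ n) t0 y" "T y s" by auto
  then show ?thesis using that depth_le by blast
qed

text \<open>Descending from \<open>t\<close> strictly lowers the depth, which is at most
  \<open>depth s\<close> at the start, so \<open>s\<close> is never met. The root edge, which also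
  avoids \<open>s\<close>, finally leads to \<open>s0\<close>.\<close>

lemma connected_avoiding:
  assumes "depth t \<le> depth s" "t \<noteq> s" "s \<noteq> s0" "s \<noteq> t0"
  shows "(adj_on T (- {s}))\<^sup>*\<^sup>* s0 t"
  using assms
proof (induction "depth t" arbitrary: t rule: less_induct)
  case less
  show ?case
  proof (cases "depth t")
    case 0
    then have "t = s0 \<or> t = t0" using depth_eq_0_iff by blast
    then show ?thesis using root_edge less.prems
      by (cases "t = s0") (auto simp: adj_on_def intro!: r_into_rtranclp)
  next
    case (Suc n)
    then obtain y where y: "T y t" "depth y \<le> n" by (rule depth_Suc_parent)
    then have "y \<noteq> s" using less.prems Suc by auto
    then have "(adj_on T (- {s}))\<^sup>*\<^sup>* s0 y" using less y Suc by auto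
    moreover have "adj_on T (- {s}) y t" using y \<open>y \<noteq> s\<close> less.prems by (simp add: adj_on_def)
    ultimately show ?thesis by (rule rtranclp.rtrancl_into_rtrancl)
  qed
qed

lemma adj_on_rtranclp_sym:
  "(adj_on T S)\<^sup>*\<^sup>* x y \<Longrightarrow> (adj_on T S)\<^sup>*\<^sup>* y x"
  by (rule sympD[OF symp_rtranclp]) (auto simp: symp_def adj_on_def T_sym)

text \<open>Two such neighbors would be joined through \<open>s0\<close> without meeting
  \<open>s\<close>, and \<open>s\<close> would close a cycle.\<close>

lemma lower_neighbor_unique:
  assumes "s \<noteq> s0" "s \<noteq> t0" "T s t" "T s t'" "depth t \<le> depth s" "depth t' \<le> depth s"
  shows "t = t'"
proof (rule ccontr)
  assume "t \<noteq> t'"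
  have ne: "t \<noteq> s" "t' \<noteq> s" using assms T_irrefl by auto
  have "(adj_on T (- {s}))\<^sup>*\<^sup>* t t'"
    using connected_avoiding[of t s] connected_avoiding[of t' s] assms ne adj_on_rtranclp_sym
    by (meson rtranclp_trans)
  then show False
    using acyclic_graph_no_detour T_acyclic T_symp assms ne \<open>t \<noteq> t'\<close> by metis
qed

text \<open>
  The two ends of the root edge are parents of each other, so that the gates of their cells are the
  two ends of the edge at the origin.
\<close>

definition parent :: "'a \<Rightarrow> 'a" where
  "parent s = (if s = s0 then t0 else if s = t0 then s0 else (SOME t. T s t \<and> depth t < depth s))"

lemma parent_root [simp]: "parent s0 = t0" "parent t0 = s0"
  using root_edge T_irrefl by (auto simp: parent_def)

lemma parent_props:
  assumes "s \<noteq> s0" "s \<noteq> t0"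
  shows "T s (parent s)" "depth (parent s) < depth s"
proof -
  obtain n where "depth s = Suc n" using assms depth_eq_0_iff not0_implies_Suc by blast
  then have "\<exists>t. T s t \<and> depth t < depth s"
    by (metis T_sym depth_Suc_parent le_imp_less_Suc)
  from someI_ex[OF this] have "T s (parent s) \<and> depth (parent s) < depth s"
    using assms unfolding parent_def by simp
  then show "T s (parent s)" "depth (parent s) < depth s" by auto
qed

lemma T_parent: "T s (parent s)"
  using parent_props(1)[of s] root_edge T_sym[OF root_edge] by (cases "s = s0 \<or> s = t0") auto

text \<open>The end of no greater depth is the parent of the other one, by uniqueness of the lower
  neighbor; on the root edge both alternatives hold.\<close>

lemma adjacent_cases:
  assumes "T s t"
  shows "t = parent s \<or> s = parent t"
proof -
  have *: "y = parent x" if "T x y" "depth y \<le> depth x" for x y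
  proof (cases "x = s0 \<or> x = t0")
    case True
    then have "depth x = 0" using depth_eq_0_iff by simp
    then have "y = s0 \<or> y = t0" using that depth_eq_0_iff[of y] by simp
    then show ?thesis using True that T_irrefl by auto
  next
    case False
    then show ?thesis
      using lower_neighbor_unique[of x y "parent x"] that parent_props[of x] by auto
  qed
  show ?thesis using *[of s t] *[of t s] assms T_sym by (meson nle_le)
qed

lemma mutual_parent:
  assumes "parent s = t" "parent t = s"
  shows "s = s0 \<and> t = t0 \<or> s = t0 \<and> t = s0"
proof (cases "s \<in> {s0, t0} \<or> t \<in> {s0, t0}")
  case True
  then show ?thesis using assms by auto
next
  case False
  then show ?thesis using parent_props(2)[of s] parent_props(2)[of t] assms by auto
qed

lemma depth_parent: "s \<noteq> s0 \<Longrightarrow> s \<noteq> t0 \<Longrightarrow> depth s = Suc (depth (parent s))"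
proof -
  assume s: "s \<noteq> s0" "s \<noteq> t0"
  have "(T ^^ Suc (depth (parent s))) s0 s \<or> (T ^^ Suc (depth (parent s))) t0 s"
    using depth_walk[of "parent s"] T_parent[of s] T_sym by (auto intro: relpowp_Suc_I)
  then show ?thesis using depth_le parent_props(2)[OF s] by (meson Suc_leI le_antisym)
qed

text \<open>Passing to the parent lowers the depth except at the two ends of the root edge, which
  therefore both serve as base cases.\<close>

lemma parent_induct [case_names root1 root2 step]:
  assumes "P s0" "P t0" "\<And>s. s \<noteq> s0 \<Longrightarrow> s \<noteq> t0 \<Longrightarrow> P (parent s) \<Longrightarrow> P s"
  shows "P s"
  by (induction "depth s" arbitrary: s rule: less_induct) (metis assms parent_props(2))

text \<open>The descendants of \<open>u\<close>, with \<open>u\<close> included. The side conditions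
  keep \<open>s0\<close> and \<open>t0\<close>, which are parents of each other, from being mutual
  descendants, so they split the tree into two halves.\<close>

inductive below :: "'a \<Rightarrow> 'a \<Rightarrow> bool" for u where
  self: "below u u"
| child: "below u (parent s) \<Longrightarrow> s \<noteq> s0 \<Longrightarrow> s \<noteq> t0 \<Longrightarrow> below u s"

lemma below_root: "below u s0 \<longleftrightarrow> u = s0" "below u t0 \<longleftrightarrow> u = t0"
  by (auto elim: below.cases intro: below.self)

text \<open>A step to a child stays below \<open>u\<close>; a step to the parent leaves only from
  \<open>u\<close> itself.\<close>

lemma below_leave:
  assumes "below u s" "T s t" "\<not> below u t"
  shows "s = u" "t = parent u"
proof -
  have "t = parent s"
  proof (rule ccontr)
    assume *: "t \<noteq> parent s"
    then have "s = parent t" using adjacent_cases assms(2) by blast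
    then have "t \<noteq> s0" "t \<noteq> t0" using * by auto
    then show False using assms \<open>s = parent t\<close> below.child by metis
  qed
  moreover have "s = u" using assms \<open>t = parent s\<close> by (auto elim: below.cases)
  ultimately show "s = u" "t = parent u" by auto
qed

lemma below_some_root: "below s0 s \<or> below t0 s"
  by (induction s rule: parent_induct) (auto intro: below.intros)

text \<open>Depth does not decrease towards descendants, whereas parents are less deep. At the root
  edge the depths agree, and \<open>below_root\<close> decides.\<close>

lemma not_below_parent: "\<not> below u (parent u)"
proof
  assume *: "below u (parent u)"
  have "depth u \<le> depth s" if "below u s" for s
    using that by induction (auto dest: parent_props(2))
  then have "depth u \<le> depth (parent u)" using * .
  then have "u = s0 \<or> u = t0" using parent_props(2)[of u] by fastforce
  then show False using * below_root root_edge T_irrefl by auto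
qed

end


subsection \<open>Gates and cells\<close>

lemma component_restrict:
  assumes "S' \<subseteq> S" "\<And>x y. x \<in> S' \<Longrightarrow> y \<in> S \<Longrightarrow> E x y \<Longrightarrow> y \<in> S'" "x \<in> S \<Longrightarrow> x \<in> S'"
  shows "component E S x = component E S' x"
proof -
  have "y \<in> S' \<and> (adj_on E S')\<^sup>*\<^sup>* x y" if "(adj_on E S)\<^sup>*\<^sup>* x y" "x \<in> S" for y
    using that
  proof (induction rule: rtranclp_induct)
    case (step y z)
    then have "z \<in> S'" using assms(2) by (auto simp: adj_on_def)
    then have "adj_on E S' y z" using step by (auto simp: adj_on_def)
    then show ?case using step \<open>z \<in> S'\<close> by (auto intro: rtranclp.rtrancl_into_rtrancl)
  qed (use assms in auto)
  moreover have "(adj_on E S)\<^sup>*\<^sup>* x y" if "(adj_on E S')\<^sup>*\<^sup>* x y" for y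
    using that by (rule rtranclp_mono[THEN predicate2D, rotated])
      (use assms(1) in \<open>auto simp: adj_on_def\<close>)
  ultimately show ?thesis
    using assms unfolding component_def by blast
qed

text \<open>Serves as induction over a component: a property that passes along edges spreads from
  the start vertex to all of it.\<close>

lemma component_stable:
  assumes "y \<in> component E S x" "P x" "\<And>v w. v \<in> S \<Longrightarrow> w \<in> S \<Longrightarrow> E v w \<Longrightarrow> P v \<Longrightarrow> P w"
  shows "y \<in> S \<and> P y"
proof -
  have "(adj_on E S)\<^sup>*\<^sup>* x y" "x \<in> S" using assms(1) by (auto simp: component_def)
  then show ?thesis
    by (induction rule: rtranclp_induct) (use assms in \<open>auto simp: adj_on_def\<close>)
qed

lemma outer_outer [simp]: "outer (outer v) = v"
  and fst_outer [simp]: "fst (outer v) = snd v"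
  and snd_outer [simp]: "snd (outer v) = fst v"
  by (auto simp: outer_def)

lemma outer_eq_iff: "outer v = w \<longleftrightarrow> v = outer w"
  by auto

lemma in_cell_iff: "v \<in> cactus_cell T s \<longleftrightarrow> fst v = s \<and> T (fst v) (snd v)"
  by (cases v) (auto simp: cactus_cell_def)

lemma in_union_of_cells_iff:
  assumes "union_of_cells T X"
  shows "v \<in> X \<longleftrightarrow> T (fst v) (snd v) \<and> fst v \<in> fst ` X"
proof -
  obtain A where "X = (\<Union>s\<in>A. cactus_cell T s)" using assms unfolding union_of_cells_def by blast
  then show ?thesis by (auto simp: in_cell_iff)
qed

text \<open>If \<open>U\<close> is allowed, a forbidden set of the extended graph contains
  \<open>None\<close>, and then also \<open>r\<close>, the only neighbor of \<open>None\<close>.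
  Dropping \<open>None\<close> costs a neighbor only at \<open>r\<close>, which turns weak
  allowedness into a condition on subsets of \<open>U\<close>.\<close>

lemma strongly_allowed_iff:
  assumes "\<And>v. v \<in> U \<Longrightarrow> finite {w. E v w}"
  shows "strongly_allowed E h U r \<longleftrightarrow> allowed E h U \<and>
    \<not> (\<exists>F\<subseteq>U. r \<in> F \<and> (\<forall>v\<in>F. h v \<le> card {w \<in> F. E v w} + of_bool (v = r)))"
    (is "_ \<longleftrightarrow> _ \<and> \<not> ?weak")
proof -
  let ?A = "attach_adj E r"
  have card_Some: "card {w \<in> V. ?A (Some v) w} =
      card {w. Some w \<in> V \<and> E v w} + of_bool (v = r \<and> None \<in> V)" if "v \<in> U" for V v
  proof -
    have "{w \<in> V. ?A (Some v) w} =
        Some ` {w. Some w \<in> V \<and> E v w} \<union> (if v = r \<and> None \<in> V then {None} else {})"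
    proof (intro set_eqI)
      fix w show "w \<in> {w \<in> V. ?A (Some v) w} \<longleftrightarrow> w \<in> Some ` {w. Some w \<in> V \<and> E v w} \<union>
          (if v = r \<and> None \<in> V then {None} else {})"
        by (cases w) auto
    qed
    moreover have "finite {w. Some w \<in> V \<and> E v w}"
      using assms[OF that] by (rule rev_finite_subset) auto
    ultimately show ?thesis
      by (cases "v = r \<and> None \<in> V") (auto simp: card_image card_insert_if)
  qed
  have "has_FSC ?A (insert None (Some ` U)) (case_option 1 h) \<longleftrightarrow> ?weak" if al: "allowed E h U"
  proof
    assume "has_FSC ?A (insert None (Some ` U)) (case_option 1 h)"
    then obtain V where V: "V \<subseteq> insert None (Some ` U)" "V \<noteq> {}"
      "\<forall>v\<in>V. case_option 1 h v \<le> card {w \<in> V. ?A v w}"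
      unfolding has_FSC_def forbidden_subconfiguration_def by auto
    define F where "F = {v. Some v \<in> V}"
    have F_U: "F \<subseteq> U" using V(1) by (auto simp: F_def)
    have le: "h v \<le> card {w \<in> F. E v w} + of_bool (v = r \<and> None \<in> V)" if "v \<in> F" for v
    proof -
      have "Some v \<in> V" using that by (simp add: F_def)
      then have "h v \<le> card {w \<in> V. ?A (Some v) w}" using V(3) by fastforce
      then show ?thesis using card_Some[of v V] that F_U by (auto simp: F_def)
    qed
    have "None \<in> V"
    proof (rule ccontr)
      assume n: "None \<notin> V"
      obtain x where "x \<in> V" using V(2) by blast
      then have "F \<noteq> {}" using n by (cases x) (auto simp: F_def)
      moreover have "\<forall>v\<in>F. h v \<le> card {w \<in> F. E v w}" using le n by simp
      ultimately show False
        using al F_U unfolding allowed_def has_FSC_def forbidden_subconfiguration_def by blast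
    qed
    then have "1 \<le> card {w \<in> V. ?A None w}" using V(3) by fastforce
    then have "{w \<in> V. ?A None w} \<noteq> {}" by (metis card.empty not_one_le_zero)
    then obtain w where "w \<in> V" "?A None w" by blast
    then have "r \<in> F" by (cases w) (auto simp: F_def)
    moreover have "\<forall>v\<in>F. h v \<le> card {w \<in> F. E v w} + of_bool (v = r)"
      using le \<open>None \<in> V\<close> by simp
    ultimately show ?weak using F_U by blast
  next
    assume ?weak
    then obtain F where F: "F \<subseteq> U" "r \<in> F"
      "\<forall>v\<in>F. h v \<le> card {w \<in> F. E v w} + of_bool (v = r)" by blast
    \<comment> \<open>Adding \<open>None\<close> restores the neighbor of \<open>r\<close> that
      \<open>of_bool\<close> counts.\<close>
    let ?V = "insert None (Some ` F)"
    have "case_option 1 h v \<le> card {w \<in> ?V. ?A v w}" if "v \<in> ?V" for v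
    proof (cases v)
      case None
      have "{w \<in> ?V. ?A None w} = {Some r}"
      proof (intro set_eqI)
        fix w show "w \<in> {w \<in> ?V. ?A None w} \<longleftrightarrow> w \<in> {Some r}"
          using F(2) by (cases w) auto
      qed
      then show ?thesis using None by simp
    next
      case (Some x)
      then have "x \<in> F" using that by auto
      moreover have "{w. Some w \<in> ?V \<and> E x w} = {w \<in> F. E x w}" by auto
      ultimately show ?thesis using card_Some[of x ?V] F Some by auto
    qed
    then have "forbidden_subconfiguration ?A (case_option 1 h) ?V"
      unfolding forbidden_subconfiguration_def by blast
    moreover have "?V \<subseteq> insert None (Some ` U)" using F by auto
    ultimately show "has_FSC ?A (insert None (Some ` U)) (case_option 1 h)"
      unfolding has_FSC_def by blast
  qed
  moreover have "allowed E h U \<and> \<not> ?weak" if "U = {}"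
    using that by (auto simp: allowed_def has_FSC_def forbidden_subconfiguration_def)
  ultimately show ?thesis unfolding strongly_allowed_def by blast
qed

section \<open>Neighbors, subtrees and bridges in the cactus\<close>

locale cactus_cluster =
  fixes T :: "'a \<Rightarrow> 'a \<Rightarrow> bool"
    and G C :: "('a \<times> 'a) set"
    and orig :: "'a \<times> 'a"
    and h :: "'a \<times> 'a \<Rightarrow> nat"
  assumes tree': "three_regular_tree T"
    and G_cactus: "finite_expanded_cactus T G"
    and orig_in_G: "orig \<in> G"
    and config_h: "configuration G h"
    and C_cluster: "cluster T G C"
    and C_origin: "cell_of T orig \<subseteq> C"
begin

abbreviation "s0 \<equiv> fst orig"
abbreviation "t0 \<equiv> snd orig"
abbreviation "adj \<equiv> cactus_adj T"
abbreviation "cell \<equiv> cactus_cell T"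

lemma G_cells: "union_of_cells T G" and C_cells: "union_of_cells T C"
  and G_connected: "connected_in adj G" and C_connected: "connected_in adj C"
  and finite_G: "finite G" and C_subset: "C \<subseteq> G"
  using G_cactus C_cluster unfolding finite_expanded_cactus_def cluster_def by auto

lemma T_orig: "T s0 t0"
  using in_union_of_cells_iff[OF G_cells] orig_in_G by blast

sublocale rooted_tree T s0 t0
  using tree' T_orig by unfold_locales

lemma orig_in_C: "orig \<in> C"
  using C_origin T_orig by (auto simp: cell_of_def in_cell_iff)

lemmas in_G_iff = in_union_of_cells_iff[OF G_cells]
lemmas in_C_iff = in_union_of_cells_iff[OF C_cells]

lemma in_G_T: "v \<in> G \<Longrightarrow> T (fst v) (snd v)"
  using in_G_iff by blast

lemma cell_subset_G: "s \<in> fst ` G \<Longrightarrow> cell s \<subseteq> G"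
  using in_G_iff in_cell_iff by (metis subsetI)

lemma cell_subset_C: "s \<in> fst ` C \<Longrightarrow> cell s \<subseteq> C"
  using in_C_iff in_cell_iff by (metis subsetI)

definition gate :: "'a \<Rightarrow> 'a \<times> 'a" where
  "gate s = (s, parent s)"

lemma fst_gate [simp]: "fst (gate s) = s" and snd_gate [simp]: "snd (gate s) = parent s"
  by (auto simp: gate_def)

lemma gate_root [simp]: "gate s0 = orig" "gate t0 = outer orig"
  by (auto simp: gate_def outer_def)

lemma gate_in_cell: "gate s \<in> cell s"
  by (simp add: in_cell_iff T_parent)

lemma outer_ne: "T (fst v) (snd v) \<Longrightarrow> outer v \<noteq> v"
  by (metis T_irrefl fst_outer)

lemma adj_sym: "adj v w \<Longrightarrow> adj w v"
  unfolding cactus_adj_def by (metis outer_outer)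

lemma adj_irrefl: "\<not> adj v v"
  unfolding cactus_adj_def by (metis outer_ne)

lemma adj_outer: "T (fst v) (snd v) \<Longrightarrow> adj v (outer v)"
  by (auto simp: cactus_adj_def T_sym)

lemma adj_same_cell: "v \<in> cell s \<Longrightarrow> w \<in> cell s \<Longrightarrow> v \<noteq> w \<Longrightarrow> adj v w"
  by (auto simp: cactus_adj_def in_cell_iff)

lemma adj_cases:
  assumes "adj v w"
  obtains "fst w = fst v" "T (fst v) (snd v)" "T (fst w) (snd w)" "v \<noteq> w"
  | "w = outer v" "T (fst v) (snd v)"
  using assms that unfolding cactus_adj_def by metis

text \<open>The tree edge at a non-gate vertex leads to a child, and its other end is the gate of
  the child.\<close>

lemma nongate:
  assumes "T (fst a) (snd a)" "a \<noteq> gate (fst a)"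
  shows "parent (snd a) = fst a" "outer a = gate (snd a)" "snd a \<noteq> s0" "snd a \<noteq> t0"
proof -
  have ne: "snd a \<noteq> parent (fst a)" using assms(2) by (metis gate_def prod.collapse)
  then show p: "parent (snd a) = fst a" using adjacent_cases[OF assms(1)] by auto
  then show "outer a = gate (snd a)" by (simp add: gate_def outer_def)
  show "snd a \<noteq> s0" "snd a \<noteq> t0" using p ne parent_root by metis+
qed

lemma cell_third:
  assumes "v \<in> cell s"
  obtains x y where "cell s = {v, x, y}" "distinct [v, x, y]"
proof -
  have "cell s = Pair s ` {t. T s t}" by (auto simp: cactus_cell_def)
  then have "card (cell s) = 3" using T_card by (simp add: card_image inj_on_def)
  then have "card (cell s - {v}) = 2" using assms by simp
  then obtain x y where "cell s - {v} = {x, y}" "x \<noteq> y" by (meson card_2_iff)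
  then show ?thesis using that[of x y] assms by auto
qed

lemma cell_split:
  obtains a b where "cell s = {gate s, a, b}" "distinct [gate s, a, b]"
  using cell_third[OF gate_in_cell] by blast

lemma neighbors:
  assumes "cell s = {v, x, y}"
  shows "{w. adj v w} = {x, y, outer v} - {v}"
proof -
  have "v \<in> cell s" "x \<in> cell s" "y \<in> cell s" using assms by auto
  then have v: "fst v = s" "T (fst v) (snd v)" by (auto simp: in_cell_iff)
  have "w \<in> {v, x, y} \<longleftrightarrow> fst w = s \<and> T (fst w) (snd w)" for w
    using assms in_cell_iff by metis
  moreover have "adj v w \<longleftrightarrow> fst w = s \<and> T (fst w) (snd w) \<and> w \<noteq> v \<or> w = outer v" for w
    unfolding cactus_adj_def using v T_sym[OF v(2)] by (metis fst_outer snd_outer)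
  ultimately have "adj v w \<longleftrightarrow> w \<in> {x, y, outer v} - {v}" for w
    using outer_ne[OF v(2)] by (metis Diff_iff insert_iff singleton_iff)
  then show ?thesis by blast
qed

lemma outer_notin_cell: "v \<in> cell s \<Longrightarrow> outer v \<notin> cell s"
  using outer_ne T_irrefl by (metis fst_outer in_cell_iff)

lemma card_neighbors:
  assumes "cell s = {v, x, y}" "distinct [v, x, y]"
  shows "card {w \<in> S. adj v w} = of_bool (x \<in> S) + of_bool (y \<in> S) + of_bool (outer v \<in> S)"
proof -
  have "outer v \<notin> {v, x, y}" using outer_notin_cell[of v s] assms by auto
  then have d: "v \<notin> {x, y, outer v}" "distinct [x, y, outer v]"
    using assms(2) by (simp_all add: eq_commute[of _ "outer v"])
  then have "{w. adj v w} = {x, y, outer v}" 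
    unfolding neighbors[OF assms(1)] by (intro Diff_triv) simp
  moreover have "{w \<in> S. adj v w} = S \<inter> {w. adj v w}" by (simp only: Collect_conj_eq Collect_mem_eq)
  moreover note d
  ultimately show ?thesis by (simp add: Int_insert_right)
qed

lemma finite_neighbors: "finite {w. adj v w}"
proof (cases "T (fst v) (snd v)")
  case True
  then have "v \<in> cell (fst v)" by (simp add: in_cell_iff)
  then obtain x y where "cell (fst v) = {v, x, y}" by (rule cell_third)
  then show ?thesis using neighbors by simp
next
  case False
  then have "{w. adj v w} = {}" by (auto simp: cactus_adj_def)
  then show ?thesis by (metis finite.emptyI)
qed

lemma finite_neighbors_in: "finite {w \<in> S. adj v w}"
  using finite_neighbors[of v] by (rule rev_finite_subset) auto

lemma degree_le:
  assumes "T (fst v) (snd v)"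
  shows "card {w \<in> S. adj v w} \<le> 3"
proof -
  have "v \<in> cell (fst v)" using assms by (simp add: in_cell_iff)
  then obtain x y where "cell (fst v) = {v, x, y}" "distinct [v, x, y]" by (rule cell_third)
  then show ?thesis using card_neighbors[of "fst v" v x y S] by (simp add: of_bool_def)
qed

text \<open>Consequently a vertex of height 3 cannot belong to a forbidden set that misses one of
  its neighbors.\<close>

lemma degree_less:
  assumes "adj v w" "w \<notin> S"
  shows "card {w \<in> S. adj v w} < 3"
proof -
  have "{w \<in> S. adj v w} \<subset> {w' \<in> insert w S. adj v w'}" using assms by blast
  then have "card {w \<in> S. adj v w} < card {w' \<in> insert w S. adj v w'}"
    by (intro psubset_card_mono finite_neighbors_in)
  also have "\<dots> \<le> 3" using assms by (intro degree_le) (auto simp: cactus_adj_def)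
  finally show ?thesis .
qed

text \<open>An edge between different cells joins some \<open>v\<close> to \<open>outer v\<close>
  and thus projects to a tree edge, so \<open>below_leave\<close> applies. This is the bridge
  property behind all later separation arguments.\<close>

lemma leave_below:
  assumes "adj v w" "below u (fst v)" "\<not> below u (fst w)"
  shows "v = gate u" "w = outer (gate u)"
proof -
  have "fst w \<noteq> fst v" using assms by auto
  with assms(1) have "w = outer v" "T (fst v) (snd v)" by (auto elim: adj_cases)
  moreover have "T (fst v) (fst w)" using calculation by simp
  ultimately have "fst v = u" "fst w = parent u" using below_leave assms by blast+
  then show "v = gate u" using \<open>w = outer v\<close> by (metis fst_outer gate_def prod.collapse)
  then show "w = outer (gate u)" using \<open>w = outer v\<close> by simp
qed

text \<open>Without the parent cell, no walk in \<open>X\<close> from the origin could cross the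
  bridge at \<open>gate s\<close>.\<close>

lemma parent_closed:
  assumes X: "union_of_cells T X" "connected_in adj X" "orig \<in> X"
    and s: "s \<in> fst ` X" "s \<noteq> s0"
  shows "parent s \<in> fst ` X"
proof (rule ccontr)
  assume p: "parent s \<notin> fst ` X"
  obtain v where v: "v \<in> X" "fst v = s" using s by auto
  then have "v \<in> component adj X orig" using X unfolding connected_in_def by blast
  then have "v \<in> X \<and> \<not> below s (fst v)"
  proof (rule component_stable)
    show "\<not> below s (fst orig)" using s by (simp add: below_root)
  next
    fix v w assume "v \<in> X" "w \<in> X" "adj v w" "\<not> below s (fst v)"
    then show "\<not> below s (fst w)"
      using leave_below[of w v s] adj_sym p by (metis fst_outer image_eqI snd_gate)
  qed
  then show False using v by (simp add: below.self)
qed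

lemma parent_in_G: "s \<in> fst ` G \<Longrightarrow> s \<noteq> s0 \<Longrightarrow> parent s \<in> fst ` G"
  using parent_closed G_cells G_connected orig_in_G by blast

lemma parent_in_C: "s \<in> fst ` C \<Longrightarrow> s \<noteq> s0 \<Longrightarrow> parent s \<in> fst ` C"
  using parent_closed C_cells C_connected orig_in_C by blast

lemma below_in_C: "below u s \<Longrightarrow> s \<in> fst ` C \<Longrightarrow> u \<in> fst ` C"
  by (induction rule: below.induct) (auto intro: parent_in_C)

lemma below_in_G: "below u s \<Longrightarrow> s \<in> fst ` G \<Longrightarrow> u \<in> fst ` G"
  by (induction rule: below.induct) (auto intro: parent_in_G)

lemma gate_in_C: "gate s \<in> C \<longleftrightarrow> s \<in> fst ` C"
  using in_C_iff[of "gate s"] T_parent by auto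

lemma gate_in_G: "gate s \<in> G \<longleftrightarrow> s \<in> fst ` G"
  using in_G_iff[of "gate s"] T_parent by auto

lemma outer_gate_in_C: "s \<in> fst ` C \<Longrightarrow> s \<noteq> s0 \<Longrightarrow> outer (gate s) \<in> C"
  using in_C_iff[of "outer (gate s)"] parent_in_C T_parent T_sym by auto

text \<open>In a deepest cell met by \<open>S\<close>, the outward neighbor of a non-gate vertex
  \<open>a\<close> lies deeper and hence outside \<open>S\<close>. Either \<open>a\<close> lies in
  \<open>S\<close> and misses this neighbor, or \<open>v\<close> misses the neighbor
  \<open>a\<close>.\<close>

lemma dissipative:
  assumes "S \<subseteq> G" "S \<noteq> {}"
  shows "\<exists>v\<in>S. card {w \<in> S. adj v w} < 3"
proof -
  have "finite S" using assms finite_G finite_subset by blast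
  define d where "d = Max ((\<lambda>v. depth (fst v)) ` S)"
  have "d \<in> (\<lambda>v. depth (fst v)) ` S"
    unfolding d_def using \<open>finite S\<close> assms by (intro Max_in) auto
  then obtain v where v: "v \<in> S" "depth (fst v) = d" by auto
  have max: "depth (fst w) \<le> d" if "w \<in> S" for w
    unfolding d_def using \<open>finite S\<close> that by simp
  have vT: "T (fst v) (snd v)" using v assms in_G_iff by blast
  obtain a b where ab: "cell (fst v) = {gate (fst v), a, b}" "distinct [gate (fst v), a, b]"
    by (rule cell_split)
  have "a \<in> cell (fst v)" using ab by auto
  then have a: "fst a = fst v" "T (fst a) (snd a)" by (auto simp: in_cell_iff)
  moreover have "a \<noteq> gate (fst a)" using ab a by auto
  ultimately have "depth (snd a) = Suc d"
    using nongate[of a] depth_parent[of "snd a"] v by auto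
  then have "outer a \<notin> S" using max[of "outer a"] by auto
  show ?thesis
  proof (cases "a \<in> S")
    case True
    then show ?thesis using degree_less[OF adj_outer[OF a(2)] \<open>outer a \<notin> S\<close>] by blast
  next
    case False
    then have "adj v a" using v a vT by (auto simp: cactus_adj_def)
    then show ?thesis using degree_less[of v a S] False v by blast
  qed
qed

sublocale sandpile adj G h orig
proof (unfold_locales, goal_cases)
  case (4 v)
  then have "T (fst v) (snd v)" using in_G_iff by blast
  then show ?case using finite_neighbors degree_le[of v UNIV] by simp
next
  case (5 S)
  then show ?case by (rule dissipative)
qed (fact finite_G config_h orig_in_G | erule adj_sym | rule adj_irrefl)+


subsection \<open>Distances\<close>

text \<open>For \<open>r\<close> an end of the root edge, this is one of the two decorated rooted
  subtrees obtained by cutting the edge at the origin.\<close>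

definition side :: "'a \<Rightarrow> ('a \<times> 'a) set" where
  "side r = {v \<in> G. below r (fst v)}"

text \<open>The distance to the root vertex of the own half: two steps from a gate to the gate of a
  child, and one more for a non-gate vertex.\<close>

definition level :: "'a \<times> 'a \<Rightarrow> nat" where
  "level v = 2 * depth (fst v) + of_bool (v \<noteq> gate (fst v))"

text \<open>Yields the lower bound for distances; the upper bound comes from explicit walks.\<close>

lemma level_adj:
  assumes "adj v w"
  shows "level w \<le> Suc (level v)"
  using assms
proof (cases rule: adj_cases)
  case 1
  then show ?thesis by (simp add: level_def)
next
  case 2
  show ?thesis
  proof (cases "v = gate (fst v)")
    case True
    then have sw: "fst w = parent (fst v)" using 2 by (metis fst_outer snd_gate)
    show ?thesis
    proof (cases "fst v = s0 \<or> fst v = t0")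
      case True
      then have "fst w = s0 \<or> fst w = t0" using sw by auto
      then show ?thesis using depth_eq_0_iff[of "fst w"] by (simp add: level_def)
    next
      case False
      then show ?thesis using sw depth_parent[of "fst v"] by (simp add: level_def)
    qed
  next
    case False
    then show ?thesis
      using nongate[of v] 2 depth_parent[of "snd v"] by (simp add: level_def)
  qed
qed

lemma level_walk: "(adj_on adj U ^^ n) v w \<Longrightarrow> level w \<le> level v + n"
proof (induction n arbitrary: w)
  case (Suc n)
  then obtain y where "(adj_on adj U ^^ n) v y" "adj_on adj U y w" by auto
  moreover from this have "adj y w" by (simp add: adj_on_def)
  ultimately show ?case using Suc.IH[of y] level_adj[of y w] by simp
qed simp

lemma side_walk_gate:
  assumes "r = s0 \<or> r = t0" "below r s" "s \<in> fst ` G"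
  shows "(adj_on adj (side r) ^^ level (gate s)) (gate r) (gate s)"
  using assms(2,3)
proof (induction rule: below.induct)
  case self
  then show ?case using assms(1) depth_eq_0_iff[of r] by (simp add: level_def)
next
  case (child s)
  let ?A = "adj_on adj (side r)" and ?p = "parent s"
  have p: "?p \<in> fst ` G" using child parent_in_G by blast
  \<comment> \<open>This makes the vertex facing \<open>s\<close> different from the gate of the
    parent cell, so that the first of the two steps per generation is an edge.\<close>
  have pp: "parent ?p \<noteq> s" using mutual_parent[of s ?p] child by auto
  have ne: "gate ?p \<noteq> outer (gate s)" using pp by (simp add: gate_def outer_def)
  have mem: "gate ?p \<in> side r" "outer (gate s) \<in> side r" "gate s \<in> side r"
    using child p cell_subset_G[OF p] T_sym[OF T_parent[of s]] below.child[of r s]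
    by (auto simp: side_def gate_in_G in_cell_iff)
  have "?A (gate ?p) (outer (gate s))"
    using mem ne T_parent T_sym by (auto simp: adj_on_def cactus_adj_def)
  moreover have "?A (outer (gate s)) (gate s)"
    using mem adj_outer[of "outer (gate s)"] T_parent T_sym by (auto simp: adj_on_def)
  ultimately have "(?A ^^ Suc (Suc (level (gate ?p)))) (gate r) (gate s)"
    using child.IH[OF p] by (auto intro: relpowp_Suc_I)
  moreover have "level (gate s) = Suc (Suc (level (gate ?p)))"
    using depth_parent[of s] child by (simp add: level_def)
  ultimately show ?case by simp
qed

lemma side_walk:
  assumes "r = s0 \<or> r = t0" "v \<in> side r"
  shows "(adj_on adj (side r) ^^ level v) (gate r) v"
proof (cases "v = gate (fst v)")
  case True
  then show ?thesis using side_walk_gate[OF assms(1), of "fst v"] assms(2)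
    by (auto simp: side_def)
next
  case False
  have "T (fst v) (snd v)" "fst v \<in> fst ` G" using assms in_G_T by (auto simp: side_def)
  then have "adj_on adj (side r) (gate (fst v)) v"
    using False assms(2) T_parent by (auto simp: adj_on_def cactus_adj_def side_def gate_in_G)
  moreover have "level v = Suc (level (gate (fst v)))" using False by (simp add: level_def)
  ultimately show ?thesis
    using side_walk_gate[OF assms(1), of "fst v"] assms(2)
    by (auto simp: side_def intro: relpowp_Suc_I)
qed

lemma graph_dist_side:
  assumes "r = s0 \<or> r = t0" "v \<in> side r"
  shows "graph_dist adj (side r) (gate r) v = level v"
  unfolding graph_dist_def
proof (rule Least_equality)
  show "(adj_on adj (side r) ^^ level v) (gate r) v" by (rule side_walk[OF assms])
  have "level (gate r) = 0" using assms(1) depth_eq_0_iff[of r] by (simp add: level_def)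
  then show "level v \<le> n" if "(adj_on adj (side r) ^^ n) (gate r) v" for n
    using level_walk[OF that] by simp
qed

lemma origin_facing_iff:
  assumes "r = s0 \<or> r = t0" "cell s \<subseteq> side r"
  shows "origin_facing T (side r) (gate r) (cell s) x \<longleftrightarrow> x = gate s"
proof -
  have "graph_dist adj (side r) (gate r) v = 2 * depth s + of_bool (v \<noteq> gate s)"
    if "v \<in> cell s" for v
  proof -
    have "v \<in> side r" "fst v = s" using that assms(2) in_cell_iff[of v T s] by blast+
    then show ?thesis using graph_dist_side[OF assms(1)] by (simp add: level_def)
  qed
  then have "graph_dist adj (side r) (gate r) v < graph_dist adj (side r) (gate r) w \<longleftrightarrow>
      v = gate s \<and> w \<noteq> gate s" if "v \<in> cell s" "w \<in> cell s" for v w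
    using that by simp
  then show ?thesis
    using gate_in_cell[of s] unfolding origin_facing_def is_arg_min_def by blast
qed

text \<open>The only edge leaving a half is the one that was cut, and the walks of
  \<open>side_walk\<close> stay inside the half.\<close>

lemma component_side:
  assumes "r = s0 \<or> r = t0"
  shows "component (cut_adj adj orig (outer orig)) G (gate r) = side r"
proof (intro set_eqI iffI)
  fix v assume v: "v \<in> component (cut_adj adj orig (outer orig)) G (gate r)"
  have "v \<in> G \<and> below r (fst v)"
  proof (rule component_stable[OF v])
    show "below r (fst (gate r))" by (simp add: below.self)
  next
    fix v w assume vw: "cut_adj adj orig (outer orig) v w" "below r (fst v)"
    show "below r (fst w)"
    proof (rule ccontr)
      assume "\<not> below r (fst w)"
      then have "v = gate r" "w = outer (gate r)"
        using leave_below[of v w r] vw by (auto simp: cut_adj_def)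
      moreover have "gate r = orig \<or> gate r = outer orig" using assms gate_root by metis
      ultimately have "{v, w} = {orig, outer orig}" by auto
      then show False using vw by (simp add: cut_adj_def)
    qed
  qed
  then show "v \<in> side r" by (simp add: side_def)
next
  fix v assume v: "v \<in> side r"
  have "adj_on (cut_adj adj orig (outer orig)) G x y" if "adj_on adj (side r) x y" for x y
  proof -
    have "\<not> (below r s0 \<and> below r t0)" using assms T_irrefl T_orig below_root by metis
    then have "{x, y} \<noteq> {orig, outer orig}"
      using that by (auto simp: adj_on_def side_def doubleton_eq_iff)
    then show ?thesis using that by (auto simp: adj_on_def side_def cut_adj_def)
  qed
  then have "(adj_on (cut_adj adj orig (outer orig)) G)\<^sup>*\<^sup>* (gate r) v"
    using relpowp_imp_rtranclp[OF side_walk[OF assms v]]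
    by (metis (no_types, lifting) rtranclp_mono predicate2D predicate2I)
  moreover have "gate r \<in> G" using v below_in_G by (auto simp: side_def gate_in_G)
  ultimately show "v \<in> component (cut_adj adj orig (outer orig)) G (gate r)"
    by (simp add: component_def)
qed


subsection \<open>The filling rules in terms of gates\<close>

text \<open>The filling rules at a single cell, with the gate as origin-facing vertex and the
  radicals taken in \<open>G\<close> instead of a half.\<close>

definition cell_rule :: "'a \<Rightarrow> bool" where
  "cell_rule s \<longleftrightarrow> (\<forall>a b. cell s = {gate s, a, b} \<and> distinct [gate s, a, b] \<longrightarrow>
     h (gate s) = 3 \<and>
     (outer a \<in> C \<and> outer b \<in> C \<longrightarrow> internal_rule h a b) \<and>
     (outer a \<in> C \<and> outer b \<notin> C \<longrightarrow> medial_rule T G C h a b) \<and>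
     (outer a \<notin> C \<and> outer b \<notin> C \<longrightarrow> terminal_rule T G C h a b))"

lemma outer_in_side:
  assumes "v \<in> side r" "v \<noteq> gate r" "outer v \<in> G"
  shows "outer v \<in> side r"
proof -
  have "adj v (outer v)" using assms(1) in_G_T adj_outer by (simp add: side_def)
  then show ?thesis using leave_below[of v "outer v" r] assms by (auto simp: side_def)
qed

text \<open>The edge joining the halves ends at the origin, which lies in \<open>C\<close>; hence no
  walk outside \<open>C\<close> crosses it.\<close>

lemma radical_side:
  assumes "r = s0 \<or> r = t0" "v \<in> side r" "v \<noteq> gate r"
  shows "radical T (side r) (C \<inter> side r) v = radical T G C v"
proof -
  have "component adj (G - C) (outer v) = component adj (side r - C) (outer v)"
  proof (rule component_restrict)
    show "side r - C \<subseteq> G - C" by (auto simp: side_def)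
    show "outer v \<in> side r - C" if "outer v \<in> G - C"
      using that outer_in_side[OF assms(2,3)] by auto
    fix x y assume xy: "x \<in> side r - C" "y \<in> G - C" "adj x y"
    show "y \<in> side r - C"
    proof (rule ccontr)
      assume "y \<notin> side r - C"
      then have "x = gate r" "y = outer (gate r)"
        using leave_below[of x y r] xy by (auto simp: side_def)
      then show False using xy assms(1) orig_in_C by auto
    qed
  qed
  moreover have "side r - C \<inter> side r = side r - C" by auto
  ultimately show ?thesis by (simp add: radical_def)
qed

lemma adj_other_cell_iff:
  assumes s: "cell s \<subseteq> C \<inter> side r" and a: "a \<in> cell s" "a \<noteq> gate r"
  shows "adj_other_cell T (C \<inter> side r) (cell s) a \<longleftrightarrow> outer a \<in> C"
proof
  assume "adj_other_cell T (C \<inter> side r) (cell s) a"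
  then obtain t w where w: "cell t \<subseteq> C \<inter> side r" "cell t \<noteq> cell s" "w \<in> cell t" "adj a w"
    unfolding adj_other_cell_def cells_def by blast
  then have "fst w \<noteq> fst a" using a by (auto simp: in_cell_iff)
  then have "w = outer a" using w by (auto elim: adj_cases)
  then show "outer a \<in> C" using w by auto
next
  assume oC: "outer a \<in> C"
  have aT: "fst a = s" "T (fst a) (snd a)" using a by (auto simp: in_cell_iff)
  have "outer a \<in> side r" using outer_in_side[of a r] s a oC C_subset by auto
  then have "cell (snd a) \<subseteq> C \<inter> side r"
    using cell_subset_C[of "snd a"] imageI[OF oC, of fst] C_subset
    by (auto simp: side_def in_cell_iff)
  moreover have "outer a \<in> cell (snd a)" using aT T_sym by (simp add: in_cell_iff)
  moreover have "cell (snd a) \<noteq> cell s" using outer_notin_cell[of a s] a calculation by auto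
  ultimately show "adj_other_cell T (C \<inter> side r) (cell s) a"
    using adj_outer[OF aT(2)] unfolding adj_other_cell_def cells_def by blast
qed

lemma cells_side:
  "K \<in> cells T (C \<inter> side r) \<longleftrightarrow> (\<exists>s\<in>fst ` C. below r s \<and> K = cell s)"
proof
  assume "K \<in> cells T (C \<inter> side r)"
  then obtain s where s: "K = cell s" "cell s \<subseteq> C \<inter> side r" unfolding cells_def by blast
  then have "gate s \<in> C \<inter> side r" using gate_in_cell by blast
  then show "\<exists>s\<in>fst ` C. below r s \<and> K = cell s"
    using s(1) gate_in_C by (auto simp: side_def)
next
  assume "\<exists>s\<in>fst ` C. below r s \<and> K = cell s"
  then obtain s where s: "s \<in> fst ` C" "below r s" "K = cell s" by blast
  have "cell s \<subseteq> C" using s cell_subset_C by blast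
  then show "K \<in> cells T (C \<inter> side r)"
    using s C_subset by (auto simp: cells_def side_def in_cell_iff)
qed

lemma filling_rules_side:
  assumes r: "r = s0 \<or> r = t0"
  shows "filling_rules T (side r) (gate r) (C \<inter> side r) h \<longleftrightarrow>
    (\<forall>v\<in>C. below r (fst v) \<and> v \<noteq> gate r \<and> outer v \<notin> C \<longrightarrow> radical_allowed T G C h v) \<and>
    (\<forall>s\<in>fst ` C. below r s \<longrightarrow> cell_rule s)"
    (is "_ \<longleftrightarrow> ?A \<and> ?B")
proof -
  let ?D = "C \<inter> side r"
  have mem: "v \<in> ?D \<longleftrightarrow> v \<in> C \<and> below r (fst v)" for v
    using C_subset by (auto simp: side_def)
  have "(\<forall>v\<in>?D. v \<noteq> gate r \<and> outer v \<notin> ?D \<longrightarrow> radical_allowed T (side r) ?D h v) \<longleftrightarrow> ?A"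
  proof -
    have "outer v \<notin> ?D \<longleftrightarrow> outer v \<notin> C" if "v \<in> ?D" "v \<noteq> gate r" for v
      using that outer_in_side[of v r] C_subset by auto
    moreover have "radical_allowed T (side r) ?D h v \<longleftrightarrow> radical_allowed T G C h v"
      if "v \<in> ?D" "v \<noteq> gate r" for v
      using radical_side[OF r, of v] that by (simp add: radical_allowed_def)
    ultimately show ?thesis by (meson mem)
  qed
  moreover have "(\<forall>K\<in>cells T ?D. \<forall>x a b.
      K = {x, a, b} \<and> distinct [x, a, b] \<and> origin_facing T (side r) (gate r) K x \<longrightarrow>
        h x = 3 \<and>
        (adj_other_cell T ?D K a \<and> adj_other_cell T ?D K b \<longrightarrow> internal_rule h a b) \<and>
        (adj_other_cell T ?D K a \<and> \<not> adj_other_cell T ?D K b \<longrightarrow>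
           medial_rule T (side r) ?D h a b) \<and>
        (\<not> adj_other_cell T ?D K a \<and> \<not> adj_other_cell T ?D K b \<longrightarrow>
           terminal_rule T (side r) ?D h a b)) \<longleftrightarrow> ?B"
    (is "(\<forall>K\<in>_. ?R K) \<longleftrightarrow> _")
  proof -
    have ball: "(\<forall>K\<in>cells T ?D. R K) \<longleftrightarrow> (\<forall>s\<in>fst ` C. below r s \<longrightarrow> R (cell s))" for R
      using cells_side[of _ r] by metis
    have key: "?R (cell s) \<longleftrightarrow> cell_rule s" if s: "s \<in> fst ` C" "below r s" for s
    proof -
      have sub: "cell s \<subseteq> ?D" using cells_side[of "cell s" r] s unfolding cells_def by blast
      have of: "origin_facing T (side r) (gate r) (cell s) x \<longleftrightarrow> x = gate s" for x
        using origin_facing_iff[OF r] sub by auto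
      have ng: "a \<noteq> gate r" if "cell s = {gate s, a, b}" "distinct [gate s, a, b]" for a b
      proof
        assume "a = gate r"
        moreover have "fst a = s" using that in_cell_iff[of a T s] by auto
        ultimately show False using that by auto
      qed
      have eq: "adj_other_cell T ?D (cell s) a \<longleftrightarrow> outer a \<in> C"
        "radical T (side r) ?D a = radical T G C a"
        if "cell s = {gate s, a, b}" "distinct [gate s, a, b]" for a b
      proof -
        have a: "a \<in> cell s" using that by auto
        then have "a \<in> side r" using sub by blast
        then show "adj_other_cell T ?D (cell s) a \<longleftrightarrow> outer a \<in> C"
          "radical T (side r) ?D a = radical T G C a"
          using adj_other_cell_iff[OF sub a ng[OF that]] radical_side[OF r _ ng[OF that]] by simp_all
      qed
      have sw: "cell s = {gate s, b, a} \<and> distinct [gate s, b, a]"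
        if "cell s = {gate s, a, b}" "distinct [gate s, a, b]" for a b
        using that by auto
      have "(adj_other_cell T ?D (cell s) a \<longleftrightarrow> outer a \<in> C) \<and>
          (adj_other_cell T ?D (cell s) b \<longleftrightarrow> outer b \<in> C) \<and>
          (medial_rule T (side r) ?D h a b \<longleftrightarrow> medial_rule T G C h a b) \<and>
          (terminal_rule T (side r) ?D h a b \<longleftrightarrow> terminal_rule T G C h a b)"
        if "cell s = {gate s, a, b}" "distinct [gate s, a, b]" for a b
        using eq[OF that] eq[of b a] sw[OF that]
        by (simp add: medial_rule_def terminal_rule_def ordered_terminal_rule_def
            radical_stopper_def radical_allowed_def radical_strongly_allowed_def)
      then show ?thesis unfolding of cell_rule_def by blast
    qed
    show ?thesis unfolding ball by (intro ball_cong[OF refl] imp_cong[OF refl] key)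
  qed
  ultimately show ?thesis unfolding filling_rules_def by (rule conj_cong)
qed

text \<open>The first clause exempts \<open>orig\<close>: either \<open>outer orig\<close> lies in
  \<open>C\<close> and no radical is attached there, or that radical is the second half and the
  stopper clause covers it.\<close>

lemma extended_filling_rules_iff:
  "extended_filling_rules T G orig C h \<longleftrightarrow>
    (\<forall>v\<in>C. v \<noteq> orig \<and> outer v \<notin> C \<longrightarrow> radical_allowed T G C h v) \<and>
    (\<forall>s\<in>fst ` C. cell_rule s) \<and>
    (outer orig \<notin> C \<longrightarrow> radical_stopper T G C h orig)"
proof -
  have comp: "component (cut_adj adj orig (outer orig)) G orig = side s0"
    "component (cut_adj adj orig (outer orig)) G (outer orig) = side t0"
    using component_side[of s0] component_side[of t0] by simp_all
  have oC: "cell_of T (outer orig) \<subseteq> C \<longleftrightarrow> outer orig \<in> C"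
    using cell_subset_C[of t0] imageI[of "outer orig" C fst] T_sym[OF T_orig]
    by (auto simp: cell_of_def in_cell_iff)
  note f0 = filling_rules_side[of s0, OF disjI1[OF refl], unfolded gate_root]
  note f1 = filling_rules_side[of t0, OF disjI2[OF refl], unfolded gate_root]
  show ?thesis
  proof (cases "outer orig \<in> C")
    case True
    have "v \<noteq> orig \<and> v \<noteq> outer orig" if "outer v \<notin> C" for v
      using that True orig_in_C by auto
    moreover have "extended_filling_rules T G orig C h \<longleftrightarrow>
        filling_rules T (side s0) orig (C \<inter> side s0) h \<and>
        filling_rules T (side t0) (outer orig) (C \<inter> side t0) h"
      unfolding extended_filling_rules_def Let_def comp oC using True by blast
    ultimately show ?thesis
      unfolding f0 f1 using True below_some_root by meson
  next
    case False
    \<comment> \<open>Since \<open>C\<close> is closed under parents, without the cell of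
      \<open>outer orig\<close> it stays within the half of the origin.\<close>
    have all: "below s0 s \<and> \<not> below t0 s" if "s \<in> fst ` C" for s
    proof -
      have "\<not> below t0 s"
      proof
        assume "below t0 s"
        then have "t0 \<in> fst ` C" using below_in_C that by blast
        then show False using False gate_in_C[of t0] by simp
      qed
      then show ?thesis using below_some_root by blast
    qed
    have C_side: "C \<inter> side s0 = C" using all C_subset by (auto simp: side_def)
    have rad: "radical T G C orig = side t0"
    proof -
      have "component adj (G - C) (outer orig) = component adj (side t0) (outer orig)"
      proof (rule component_restrict)
        show "side t0 \<subseteq> G - C" using all by (auto simp: side_def)
        show "outer orig \<in> side t0" if "outer orig \<in> G - C"
          using that by (simp add: side_def below.self)
        show "y \<in> side t0" if "x \<in> side t0" "y \<in> G - C" "adj x y" for x y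
          using that leave_below[OF that(3), of t0] orig_in_C
          by (metis (no_types, lifting) DiffD1 DiffD2 gate_root(2) mem_Collect_eq outer_outer
              side_def)
      qed
      also have "\<dots> = side t0"
      proof
        show "component adj (side t0) (outer orig) \<subseteq> side t0"
          using component_stable[of _ adj "side t0" "outer orig" "\<lambda>_. True"] by blast
        show "side t0 \<subseteq> component adj (side t0) (outer orig)"
        proof
          fix v assume v: "v \<in> side t0"
          then have "t0 \<in> fst ` G" using below_in_G by (auto simp: side_def)
          then have "outer orig \<in> side t0"
            using gate_in_G[of t0] by (simp add: side_def below.self)
          then show "v \<in> component adj (side t0) (outer orig)"
            using relpowp_imp_rtranclp[OF side_walk[of t0 v]] v by (simp add: component_def)
        qed
      qed
      finally show ?thesis by (simp add: radical_def)
    qed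
    have "extended_filling_rules T G orig C h \<longleftrightarrow>
        filling_rules T (side s0) orig C h \<and> radical_stopper T G C h orig"
      unfolding extended_filling_rules_def Let_def comp oC radical_stopper_def rad
      using False by blast
    then show ?thesis
      using f0[unfolded C_side] False all by (meson imageI)
  qed
qed


subsection \<open>Radicals\<close>

lemma radical_subset: "radical T G C v \<subseteq> G - C"
  using component_stable[of _ adj "G - C" "outer v" "\<lambda>_. True"] unfolding radical_def by blast

lemma radical_closed:
  assumes "x \<in> radical T G C v" "y \<in> G - C" "adj x y"
  shows "y \<in> radical T G C v"
proof -
  have "x \<in> G - C" using assms radical_subset by blast
  then have "adj_on adj (G - C) x y" using assms by (simp add: adj_on_def)
  then show ?thesis using assms(1) unfolding radical_def component_def
    by (auto intro: rtranclp.rtrancl_into_rtrancl)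
qed

lemma outer_in_radical_iff: "outer v \<in> radical T G C v \<longleftrightarrow> outer v \<in> G - C"
  unfolding radical_def component_def by auto

lemma radical_nonempty: "radical T G C v \<noteq> {} \<Longrightarrow> outer v \<in> G - C"
  unfolding radical_def component_def by auto

text \<open>A gate other than \<open>orig\<close> leads to the parent cell, which belongs to
  \<open>C\<close>. So radicals hang at \<open>orig\<close> or at non-gate vertices, and their roots
  are gates.\<close>

lemma boundary:
  assumes "b \<in> C" "outer b \<notin> C"
  shows "outer b = gate (snd b)" "b = orig \<or> b \<noteq> gate (fst b)"
proof -
  show c: "b = orig \<or> b \<noteq> gate (fst b)"
    using outer_gate_in_C[of "fst b"] assms by (metis gate_root(1) imageI)
  show "outer b = gate (snd b)"
    using c nongate(2)[of b] in_G_T C_subset assms(1) by (metis gate_root(2) subsetD)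
qed

text \<open>The radical lies below \<open>snd b\<close> but no cell of \<open>C\<close> does, so an
  edge into \<open>C\<close> must be the bridge at the root.\<close>

lemma radical_leave:
  assumes b: "b \<in> C" "outer b \<notin> C" and v: "v \<in> radical T G C b" and w: "w \<in> G" "adj v w"
  shows "w \<in> radical T G C b \<or> v = outer b \<and> w = b"
proof (cases "w \<in> C")
  case True
  note g = boundary(1)[OF b]
  have "v \<in> component adj (G - C) (outer b)" using v by (simp add: radical_def)
  then have "v \<in> G - C \<and> below (snd b) (fst v)"
  proof (rule component_stable)
    show "below (snd b) (fst (outer b))" by (simp add: below.self)
    fix x y assume "x \<in> G - C" "y \<in> G - C" "adj x y" "below (snd b) (fst x)"
    then show "below (snd b) (fst y)"
      using leave_below(2)[of x y "snd b"] g b by (metis DiffD2 outer_outer)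
  qed
  moreover have "\<not> below (snd b) (fst w)"
  proof
    assume "below (snd b) (fst w)"
    then have "snd b \<in> fst ` C" using below_in_C True by blast
    then show False using gate_in_C g b by simp
  qed
  ultimately have "v = gate (snd b)" "w = outer (gate (snd b))"
    using leave_below w by blast+
  then show ?thesis using g by (metis outer_outer)
next
  case False
  then show ?thesis using radical_closed v w by blast
qed

text \<open>On a walk from the origin, a step out of \<open>C\<close> enters the radical attached
  there, and steps outside \<open>C\<close> stay in the same radical.\<close>

lemma G_covered:
  assumes "v \<in> G" "v \<notin> C"
  obtains b where "b \<in> C" "outer b \<notin> C" "v \<in> radical T G C b"
proof -
  let ?P = "\<lambda>v. v \<in> C \<or> (\<exists>b\<in>C. outer b \<notin> C \<and> v \<in> radical T G C b)"
  have "v \<in> component adj G orig"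
    using G_connected orig_in_G assms unfolding connected_in_def by blast
  then have "v \<in> G \<and> ?P v"
  proof (rule component_stable)
    show "?P orig" using orig_in_C by blast
    fix x y assume xy: "x \<in> G" "y \<in> G" "adj x y" "?P x"
    show "?P y"
    proof (cases "x \<in> C \<and> y \<notin> C")
      case True
      then have "fst x \<noteq> fst y" using cell_subset_C[of "fst x"] in_cell_iff[of y T "fst x"] in_G_T xy
        by (metis imageI subsetD)
      then have "y = outer x" using xy(3) by (auto elim: adj_cases)
      then have "y \<in> radical T G C x" using True xy outer_in_radical_iff by blast
      then show ?thesis using True \<open>y = outer x\<close> by blast
    next
      case False
      then show ?thesis using xy radical_closed by blast
    qed
  qed
  then show ?thesis using assms that by blast
qed

lemma cell_split_at:
  assumes "a \<in> cell s" "a \<noteq> gate s"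
  obtains b where "cell s = {gate s, a, b}" "distinct [gate s, a, b]"
proof -
  obtain x y where xy: "cell s = {gate s, x, y}" "distinct [gate s, x, y]" by (rule cell_split)
  then consider "a = x" | "a = y" using assms by blast
  then show ?thesis
  proof cases
    case 1
    then show ?thesis using xy that by blast
  next
    case 2
    then show ?thesis using xy that[of x] by (simp add: insert_commute eq_commute)
  qed
qed

lemma cell_members:
  assumes "cell s = {gate s, a, b}" "distinct [gate s, a, b]"
  shows "a \<in> cell s" "fst a = s" "T s (snd a)" "a \<noteq> gate s" "adj a (gate s)" "adj a b"
    "outer a = gate (snd a)" "parent (snd a) = s" "snd a \<noteq> s0" "snd a \<noteq> t0"
proof -
  have "a \<in> cell s" "b \<in> cell s" using assms by blast+
  moreover have "a \<noteq> gate s" "a \<noteq> b" using assms(2) by auto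
  moreover have "fst a = s" "T (fst a) (snd a)" using calculation(1) by (auto simp: in_cell_iff)
  ultimately show "a \<in> cell s" "fst a = s" "T s (snd a)" "a \<noteq> gate s" "adj a (gate s)" "adj a b"
    "outer a = gate (snd a)" "parent (snd a) = s" "snd a \<noteq> s0" "snd a \<noteq> t0"
    using nongate[of a] adj_same_cell[OF \<open>a \<in> cell s\<close>] gate_in_cell by auto
qed

lemma cell_swap:
  "cell s = {gate s, a, b} \<Longrightarrow> distinct [gate s, a, b] \<Longrightarrow>
    cell s = {gate s, b, a} \<and> distinct [gate s, b, a]"
  by (simp add: insert_commute eq_commute)


subsection \<open>Forbidden subconfigurations\<close>

lemma radical_strongly_allowed_iff:
  "radical_strongly_allowed T G C h b \<longleftrightarrow> radical_allowed T G C h b \<and>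
    \<not> (\<exists>F\<subseteq>radical T G C b. outer b \<in> F \<and>
         (\<forall>v\<in>F. h v \<le> card {w \<in> F. adj v w} + of_bool (v = outer b)))"
  unfolding radical_strongly_allowed_def radical_allowed_def
  by (rule strongly_allowed_iff) (rule finite_neighbors)

lemma recurrent_radical_allowed: "recurrent adj G h \<Longrightarrow> radical_allowed T G C h v"
  using radical_subset unfolding recurrent_def radical_allowed_def allowed_def has_FSC_def by blast

text \<open>
  A vertex set on which this fails, enlarged by forbidden subsets of its weakly allowed radicals,
  is a forbidden subconfiguration.
\<close>

lemma recurrent_burn:
  assumes rec: "recurrent adj G h" and X: "X \<subseteq> C" "X \<noteq> {}"
  shows "\<exists>v\<in>X. card {w \<in> X. adj v w} +
    of_bool (outer v \<notin> C \<and> \<not> radical_strongly_allowed T G C h v) < h v"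
proof (rule ccontr)
  assume "\<not> ?thesis"
  then have neg: "h v \<le> card {w \<in> X. adj v w} +
      of_bool (outer v \<notin> C \<and> \<not> radical_strongly_allowed T G C h v)" if "v \<in> X" for v
    using that by (meson not_le_imp_less)
  \<comment> \<open>\<open>Y\<close> consists of the vertices for which the extra neighbor was
    counted; each gets a set \<open>F b\<close> witnessing that its radical is weakly
    allowed.\<close>
  define Y where "Y = {v \<in> X. outer v \<notin> C \<and> \<not> radical_strongly_allowed T G C h v}"
  let ?weak = "\<lambda>b F. F \<subseteq> radical T G C b \<and> outer b \<in> F \<and>
      (\<forall>v\<in>F. h v \<le> card {w \<in> F. adj v w} + of_bool (v = outer b))"
  have "\<exists>F. ?weak b F" if "b \<in> Y" for b
  proof -
    have "\<not> radical_strongly_allowed T G C h b" using that by (simp add: Y_def)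
    then show ?thesis
      unfolding radical_strongly_allowed_iff using recurrent_radical_allowed[OF rec, of b] by blast
  qed
  then have "\<forall>b\<in>Y. \<exists>F. ?weak b F" by (rule ballI)
  from bchoice[OF this] obtain F where weak: "\<forall>b\<in>Y. ?weak b (F b)" ..
  then have F: "\<And>b. b \<in> Y \<Longrightarrow> F b \<subseteq> radical T G C b"
    "\<And>b. b \<in> Y \<Longrightarrow> outer b \<in> F b"
    "\<And>b v. b \<in> Y \<Longrightarrow> v \<in> F b \<Longrightarrow> h v \<le> card {w \<in> F b. adj v w} + of_bool (v = outer b)"
    by blast+
  define V where "V = X \<union> (\<Union>b\<in>Y. F b)"
  have F_C: "v \<notin> C" "v \<in> G" if "b \<in> Y" "v \<in> F b" for b v
    using F(1) radical_subset that by blast+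
  have "h v \<le> card {w \<in> V. adj v w}" if "v \<in> V" for v
  proof (cases "v \<in> X")
    case True
    have "T (fst v) (snd v)" using True X C_subset in_G_T by blast
    have "h v \<le> card {w \<in> X. adj v w} + of_bool (v \<in> Y)"
    proof -
      have "v \<in> Y \<longleftrightarrow> outer v \<notin> C \<and> \<not> radical_strongly_allowed T G C h v"
        using True by (simp add: Y_def)
      then show ?thesis using neg[OF True] by simp
    qed
    also have "\<dots> \<le> card {w \<in> V. adj v w}"
    proof (cases "v \<in> Y")
      case True
      \<comment> \<open>The root of the radical, an element of \<open>F v\<close>, supplies the
        extra neighbor of \<open>v\<close>.\<close>
      have o: "outer v \<in> V" "outer v \<notin> X" "adj v (outer v)"
        using F(2)[OF True] True X adj_outer[OF \<open>T (fst v) (snd v)\<close>]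
        unfolding V_def Y_def by blast+
      then have "insert (outer v) {w \<in> X. adj v w} \<subseteq> {w \<in> V. adj v w}"
        by (auto simp: V_def)
      from card_mono[OF finite_neighbors_in this] show ?thesis
        using o True finite_neighbors_in[of X v] by simp
    next
      case False
      have "{w \<in> X. adj v w} \<subseteq> {w \<in> V. adj v w}" by (auto simp: V_def)
      from card_mono[OF finite_neighbors_in this] show ?thesis using False by simp
    qed
    finally show ?thesis .
  next
    case False
    then obtain b where b: "b \<in> Y" "v \<in> F b" using \<open>v \<in> V\<close> unfolding V_def by blast
    have "h v \<le> card {w \<in> F b. adj v w} + of_bool (v = outer b)" using F(3) b by blast
    also have "\<dots> \<le> card {w \<in> V. adj v w}"
    proof (cases "v = outer b")
      case True
      \<comment> \<open>Conversely, \<open>b\<close> supplies the extra neighbor of the root in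
        \<open>F b\<close>.\<close>
      have bX: "b \<in> X" "b \<in> C" using b X unfolding Y_def by blast+
      then have "adj v b" using True adj_outer[of b] adj_sym in_G_T C_subset by blast
      then have "insert b {w \<in> F b. adj v w} \<subseteq> {w \<in> V. adj v w}"
        using b bX unfolding V_def by blast
      from card_mono[OF finite_neighbors_in this] show ?thesis
        using True F_C(1)[OF b(1), of b] bX(2) finite_neighbors_in[of "F b" v]
        by (cases "b \<in> F b") simp_all
    next
      case False
      have "{w \<in> F b. adj v w} \<subseteq> {w \<in> V. adj v w}" using b unfolding V_def by blast
      from card_mono[OF finite_neighbors_in this] show ?thesis using False by simp
    qed
    finally show ?thesis .
  qed
  moreover have "V \<subseteq> G" "V \<noteq> {}" using X C_subset F_C unfolding V_def by blast+
  ultimately show False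
    using rec unfolding recurrent_def has_FSC_def forbidden_subconfiguration_def by blast
qed

text \<open>The part of \<open>V\<close> inside the radical loses at most the neighbor
  \<open>b\<close>, and only at the root. If it contained the root, it would make the radical weakly
  allowed.\<close>

lemma FSC_avoids_strong_radical:
  assumes V: "V \<subseteq> G" "\<And>v. v \<in> V \<Longrightarrow> h v \<le> card {w \<in> V. adj v w}"
    and b: "b \<in> C" "outer b \<notin> C" "radical_strongly_allowed T G C h b"
  shows "outer b \<notin> V"
proof
  assume o: "outer b \<in> V"
  let ?F = "V \<inter> radical T G C b"
  have "outer b \<in> ?F" using o V(1) b outer_in_radical_iff by auto
  moreover have "h v \<le> card {w \<in> ?F. adj v w} + of_bool (v = outer b)" if "v \<in> ?F" for v
  proof -
    have "{w \<in> V. adj v w} \<subseteq> {w \<in> ?F. adj v w} \<union> (if v = outer b then {b} else {})"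
      using radical_leave[OF b(1,2), of v] that V(1) by auto
    then have "card {w \<in> V. adj v w} \<le>
        card ({w \<in> ?F. adj v w} \<union> (if v = outer b then {b} else {}))"
      by (intro card_mono) (simp_all add: finite_neighbors_in)
    also have "\<dots> \<le> card {w \<in> ?F. adj v w} + card (if v = outer b then {b} else {})"
      by (rule card_Un_le)
    also have "card (if v = outer b then {b} else {}) = of_bool (v = outer b)" by simp
    finally show ?thesis using V(2)[of v] that by simp
  qed
  ultimately have "\<exists>F\<subseteq>radical T G C b. outer b \<in> F \<and>
      (\<forall>v\<in>F. h v \<le> card {w \<in> F. adj v w} + of_bool (v = outer b))"
    by (intro exI[of _ ?F] conjI ballI Int_lower2)
  then show False using b(3)[unfolded radical_strongly_allowed_iff] by (elim conjE notE)
qed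

text \<open>As \<open>b\<close> is not in \<open>V\<close>, the part of \<open>V\<close> inside the
  radical loses no neighbor and would itself be forbidden there.\<close>

lemma FSC_avoids_allowed_radical:
  assumes V: "V \<subseteq> G" "\<And>v. v \<in> V \<Longrightarrow> h v \<le> card {w \<in> V. adj v w}"
    and b: "b \<in> C" "outer b \<notin> C" "radical_allowed T G C h b" "b \<notin> V"
  shows "V \<inter> radical T G C b = {}"
proof -
  let ?F = "V \<inter> radical T G C b"
  have "h v \<le> card {w \<in> ?F. adj v w}" if "v \<in> ?F" for v
  proof -
    have "{w \<in> V. adj v w} = {w \<in> ?F. adj v w}"
      using radical_leave[OF b(1,2), of v] that V(1) b(4) by blast
    then show ?thesis using V(2)[of v] that by simp
  qed
  then show ?thesis
    using b(3) unfolding radical_allowed_def allowed_def has_FSC_def forbidden_subconfiguration_def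
    by blast
qed


subsection \<open>The course of the first wave\<close>

lemma wave_step1:
  assumes "h orig = 3" "v \<in> G" "h v = 3" "w \<in> first_wave" "adj v w"
  shows "v \<in> first_wave"
proof (rule first_wave_closed[OF assms(1,2)])
  have "{w} \<subseteq> {w \<in> first_wave. adj v w}" using assms by auto
  from card_mono[OF finite_neighbors_in this] show "3 < h v + card {w \<in> first_wave. adj v w}"
    using assms by simp
qed

lemma wave_step2:
  assumes "h orig = 3" "v \<in> G" "h v \<ge> 2" "w \<in> first_wave" "adj v w" "w' \<in> first_wave" "adj v w'"
    "w \<noteq> w'"
  shows "v \<in> first_wave"
proof (rule first_wave_closed[OF assms(1,2)])
  have "{w, w'} \<subseteq> {w \<in> first_wave. adj v w}" using assms by auto
  from card_mono[OF finite_neighbors_in this] show "3 < h v + card {w \<in> first_wave. adj v w}"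
    using assms by simp
qed

lemma wave_T: "v \<in> first_wave \<Longrightarrow> T (fst v) (snd v)"
  using first_wave_subset in_G_T by blast

text \<open>Only \<open>e\<close> can have given a grain to the first vertex of \<open>B\<close> to
  topple, which therefore has height 3.\<close>

lemma wave_entry_unique:
  assumes "first_wave \<inter> B \<noteq> {}" "orig \<notin> B"
    and "\<And>v w. v \<in> B \<Longrightarrow> w \<notin> B \<Longrightarrow> adj v w \<Longrightarrow> w = e"
  obtains v where "v \<in> first_wave" "v \<in> B" "h v = 3" "e \<in> first_wave" "adj v e"
proof -
  obtain v where v: "v \<in> first_wave" "v \<in> B" "h v + card {w \<in> first_wave - B. adj v w} > 3"
    by (rule first_wave_entry[OF assms(1,2)])
  have "{w \<in> first_wave - B. adj v w} \<subseteq> {e} \<inter> {w \<in> first_wave. adj v w}"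
    using assms(3) v(2) by blast
  moreover have hv: "h v \<le> 3" using h_bounds v(1) first_wave_subset by blast
  moreover have "{w \<in> first_wave - B. adj v w} \<noteq> {}"
  proof
    assume "{w \<in> first_wave - B. adj v w} = {}"
    then show False using v(3) hv by (metis add.right_neutral card.empty not_less)
  qed
  ultimately have "{w \<in> first_wave - B. adj v w} = {e}" "e \<in> first_wave" "adj v e"
    by blast+
  then show ?thesis using v hv that by simp
qed

lemma wave_through_gate:
  assumes "s \<in> fst ` first_wave" "s \<noteq> s0"
  shows "h (gate s) = 3" "gate s \<in> first_wave" "outer (gate s) \<in> first_wave"
proof -
  let ?B = "{v. below s (fst v)}"
  obtain v where "v \<in> first_wave" "v \<in> ?B" "h v = 3" "outer (gate s) \<in> first_wave"
    "adj v (outer (gate s))"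
  proof (rule wave_entry_unique)
    show "first_wave \<inter> ?B \<noteq> {}" using assms below.self by blast
    show "orig \<notin> ?B" using assms(2) by (simp add: below_root)
    show "w = outer (gate s)" if "v \<in> ?B" "w \<notin> ?B" "adj v w" for v w
      using leave_below(2) that by blast
  qed
  moreover from this have "v = gate s"
    using leave_below(1)[of v "outer (gate s)" s] not_below_parent by simp
  ultimately show "h (gate s) = 3" "gate s \<in> first_wave" "outer (gate s) \<in> first_wave"
    by auto
qed

text \<open>The part below \<open>s\<close> without its gate can be entered from
  \<open>gate s\<close> only, and the first vertex entered is \<open>a\<close> or
  \<open>b\<close>.\<close>

lemma wave_in_cell_height3:
  assumes ab: "cell s = {gate s, a, b}" "distinct [gate s, a, b]"
    and "a \<in> first_wave \<or> b \<in> first_wave"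
  shows "h a = 3 \<or> h b = 3"
proof -
  let ?B = "{v. below s (fst v)} - {gate s}"
  note sw = cell_swap[OF ab]
  have mem: "a \<in> ?B" "b \<in> ?B"
    using cell_members[OF ab] cell_members[of s b a] sw below.self by auto
  obtain v where v: "v \<in> first_wave" "v \<in> ?B" "h v = 3" "adj v (gate s)"
  proof (rule wave_entry_unique)
    show "first_wave \<inter> ?B \<noteq> {}" using assms(3) mem by blast
    show "orig \<notin> ?B" using below_root(1)[of s] by auto
    show "w = gate s" if "v \<in> ?B" "w \<notin> ?B" "adj v w" for v w
      using leave_below(1)[of v w s] that by blast
  qed
  have "fst v = s"
  proof (rule ccontr)
    assume "fst v \<noteq> s"
    then have "v = outer (gate s)"
      using v(4) by (auto elim!: adj_cases simp: outer_eq_iff)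
    then show False using v(2) not_below_parent by simp
  qed
  then have "v \<in> cell s" using wave_T[OF v(1)] by (simp add: in_cell_iff)
  then show ?thesis using ab v by auto
qed

text \<open>The cells beyond \<open>b\<close> are reached only through \<open>b\<close>, so
  \<open>b\<close> topples before them. At that moment at most two neighbors have contributed,
  because \<open>outer b\<close> has not toppled.\<close>

lemma wave_nongate_height:
  assumes "b \<in> first_wave" "b \<noteq> gate (fst b)"
  shows "h b \<ge> 2"
proof -
  let ?B = "insert b {v. below (snd b) (fst v)}"
  note ng = nongate[OF wave_T[OF assms(1)] assms(2)]
  have "orig \<notin> ?B"
  proof -
    have "b \<noteq> orig" using assms(2) gate_root(1) by metis
    then show ?thesis using ng below_root(1)[of "snd b"] by auto
  qed
  then obtain v where v: "v \<in> first_wave" "v \<in> ?B" "h v + card {w \<in> first_wave - ?B. adj v w} > 3"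
    using first_wave_entry[of ?B] assms by blast
  have hv: "h v \<le> 3" using h_bounds v(1) first_wave_subset by blast
  have "{w \<in> first_wave - ?B. adj v w} \<noteq> {}"
  proof
    assume "{w \<in> first_wave - ?B. adj v w} = {}"
    then show False using v(3) hv by (metis add.right_neutral card.empty not_less)
  qed
  then obtain w where w: "w \<notin> ?B" "adj v w" by blast
  have vb: "v = b"
  proof (rule ccontr)
    assume "v \<noteq> b"
    then have "w = outer (gate (snd b))" using leave_below(2)[of v w] v w by blast
    then show False using w ng by (metis insertI1 outer_outer)
  qed
  have "outer b \<in> ?B" by (simp add: below.self)
  then have "card {w \<in> first_wave - ?B. adj b w} < 3"
    by (intro degree_less[OF adj_outer[OF wave_T[OF assms(1)]]]) blast
  then show ?thesis using v(3) unfolding vb by linarith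
qed

lemma cells_image:
  assumes "union_of_cells T X"
  shows "cells T X = cell ` fst ` X"
proof (intro set_eqI iffI)
  fix K assume "K \<in> cells T X"
  then obtain s where s: "K = cell s" "cell s \<subseteq> X" unfolding cells_def by blast
  then have "s \<in> fst ` X" using gate_in_cell[of s] fst_gate[of s] by (metis imageI subsetD)
  then show "K \<in> cell ` fst ` X" using s by blast
next
  fix K assume "K \<in> cell ` fst ` X"
  then obtain s where s: "K = cell s" "s \<in> fst ` X" by blast
  then have "cell s \<subseteq> X" using in_union_of_cells_iff[OF assms] in_cell_iff by (metis subsetI)
  then show "K \<in> cells T X" using s unfolding cells_def by blast
qed

text \<open>Replaces sets of cells by sets of tree vertices, using that \<open>cell\<close> is
  injective.\<close>

lemma wave_cells_iff:
  "{K \<in> cells T G. cell_topples_in_first_wave adj G h orig K} = cells T C \<longleftrightarrow>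
    fst ` first_wave = fst ` C"
proof -
  have "inj cell"
    by (rule injI) (metis fst_gate gate_in_cell in_cell_iff)
  have "cell_topples_in_first_wave adj G h orig (cell s) \<longleftrightarrow> s \<in> fst ` first_wave" for s
  proof -
    have "cell_topples_in_first_wave adj G h orig (cell s) \<longleftrightarrow> (\<exists>v\<in>cell s. v \<in> first_wave)"
      by (simp add: cell_topples_in_first_wave_def first_wave_def)
    also have "\<dots> \<longleftrightarrow> (\<exists>v\<in>first_wave. s = fst v)"
      using wave_T by (metis in_cell_iff)
    finally show ?thesis by (simp only: image_iff)
  qed
  then have "{K \<in> cells T G. cell_topples_in_first_wave adj G h orig K} =
      cell ` {s \<in> fst ` G. s \<in> fst ` first_wave}"
    unfolding cells_image[OF G_cells] by blast
  also have "{s \<in> fst ` G. s \<in> fst ` first_wave} = fst ` first_wave"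
    using first_wave_subset by blast
  finally show ?thesis
    unfolding cells_image[OF C_cells] using inj_image_eq_iff[OF \<open>inj cell\<close>] by simp
qed


subsection \<open>Necessity of the rules\<close>

context
  assumes rec: "recurrent adj G h" and wave: "fst ` first_wave = fst ` C"
begin

lemma orig_height: "h orig = 3"
  using first_wave_height_orig wave orig_in_C by blast

lemma gate_topples:
  assumes "s \<in> fst ` C"
  shows "gate s \<in> first_wave" "h (gate s) = 3"
  using wave_through_gate[of s] assms wave orig_height orig_in_first_wave
  by (cases "s = s0"; simp)+

text \<open>A root of height 3 next to the toppled \<open>b\<close> would topple too, and its cell
  would belong to \<open>C\<close>.\<close>

lemma toppled_stopper:
  assumes "b \<in> first_wave" "b \<in> C" "outer b \<notin> C"
  shows "radical_stopper T G C h b"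
proof (cases "radical T G C b = {}")
  case True
  then show ?thesis by (simp add: radical_stopper_def stopper_def)
next
  case False
  then have oG: "outer b \<in> G" using radical_nonempty by blast
  have "outer b \<notin> first_wave"
  proof
    assume "outer b \<in> first_wave"
    then have "snd b \<in> fst ` C" using wave by (metis fst_outer imageI)
    then show False using boundary(1)[OF assms(2,3)] gate_in_C assms(3) by simp
  qed
  then have "h (outer b) \<noteq> 3"
    using wave_step1[OF orig_height oG _ assms(1)] adj_sym adj_outer wave_T[OF assms(1)] by blast
  then have "h (outer b) \<in> {1, 2}"
    using config_h oG unfolding configuration_def by blast
  then show ?thesis
    using recurrent_radical_allowed[OF rec, of b]
    by (simp add: radical_stopper_def stopper_def radical_allowed_def)
qed

lemma necessary_cell_rule:
  assumes s: "s \<in> fst ` C"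
  shows "cell_rule s"
  unfolding cell_rule_def
proof (intro allI impI, elim conjE)
  fix a b assume ab: "cell s = {gate s, a, b}" "distinct [gate s, a, b]"
  note sw = cell_swap[OF ab]
  note ma = cell_members[OF ab] and mb = cell_members[OF conjunct1[OF sw] conjunct2[OF sw]]
  have abC: "a \<in> C" "b \<in> C" using cell_subset_C[OF s] ab by auto
  have abG: "a \<in> G" "b \<in> G" using abC C_subset by auto
  have ha: "h a \<in> {1, 2, 3}" and hb: "h b \<in> {1, 2, 3}"
    using config_h abG unfolding configuration_def by blast+
  note g = gate_topples[OF s]
  have ne: "a \<noteq> gate (fst a)" "b \<noteq> gate (fst b)" using ma mb by auto
  \<comment> \<open>The wave reaches the cell beyond \<open>v\<close>, and can do so only over
    \<open>v\<close>.\<close>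
  have child: "v \<in> first_wave" if "outer v \<in> C" "outer v = gate (snd v)" "snd v \<noteq> s0" for v
    using wave_through_gate(3)[of "snd v"] that wave by (metis fst_outer imageI outer_outer)
  have a3: "h a = 3 \<Longrightarrow> a \<in> first_wave" and b3: "h b = 3 \<Longrightarrow> b \<in> first_wave"
    using wave_step1[OF orig_height] abG g ma mb by blast+
  have a2: "h b = 3 \<Longrightarrow> h a \<ge> 2 \<Longrightarrow> a \<in> first_wave"
    using wave_step2[OF orig_height abG(1) _ g(1) ma(5) b3 ma(6)] mb(4) by metis
  have b2: "h a = 3 \<Longrightarrow> h b \<ge> 2 \<Longrightarrow> b \<in> first_wave"
    using wave_step2[OF orig_height abG(2) _ g(1) mb(5) a3 mb(6)] ma(4) by metis
  have some3: "a \<in> first_wave \<or> b \<in> first_wave \<Longrightarrow> h a = 3 \<or> h b = 3"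
    by (rule wave_in_cell_height3[OF ab])
  have ge2: "a \<in> first_wave \<Longrightarrow> h a \<ge> 2" "b \<in> first_wave \<Longrightarrow> h b \<ge> 2"
    using wave_nongate_height ne by blast+
  have stop: "a \<in> first_wave \<Longrightarrow> outer a \<notin> C \<Longrightarrow> radical_stopper T G C h a"
    "b \<in> first_wave \<Longrightarrow> outer b \<notin> C \<Longrightarrow> radical_stopper T G C h b"
    using toppled_stopper abC by blast+
  \<comment> \<open>Burning a single vertex: height 1 is incompatible with a weakly allowed
    radical.\<close>
  have one: "radical_strongly_allowed T G C h v" if "v \<in> C" "h v = 1" "outer v \<notin> C" for v
  proof -
    have "{w \<in> {v}. adj v w} = {}" using adj_irrefl by auto
    then show ?thesis using recurrent_burn[OF rec, of "{v}"] that by (auto split: if_splits)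
  qed
  \<comment> \<open>Burning the pair: as \<open>a\<close> and \<open>b\<close> are neighbors, one of
    them has height 3, or height 2 without a weakly allowed radical.\<close>
  have two: "h a > 1 + of_bool (outer a \<notin> C \<and> \<not> radical_strongly_allowed T G C h a) \<or>
      h b > 1 + of_bool (outer b \<notin> C \<and> \<not> radical_strongly_allowed T G C h b)"
  proof -
    have "{w \<in> {a, b}. adj a w} = {b}" "{w \<in> {a, b}. adj b w} = {a}"
      using adj_irrefl ma mb by auto
    then show ?thesis using recurrent_burn[OF rec, of "{a, b}"] abC by auto
  qed
  show "h (gate s) = 3 \<and>
     (outer a \<in> C \<and> outer b \<in> C \<longrightarrow> internal_rule h a b) \<and>
     (outer a \<in> C \<and> outer b \<notin> C \<longrightarrow> medial_rule T G C h a b) \<and>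
     (outer a \<notin> C \<and> outer b \<notin> C \<longrightarrow> terminal_rule T G C h a b)"
  proof (intro conjI impI; (elim conjE)?)
    show "h (gate s) = 3" by (rule g(2))
  next
    assume o: "outer a \<in> C" "outer b \<in> C"
    have "a \<in> first_wave" "b \<in> first_wave" using child o ma mb by blast+
    then show "internal_rule h a b"
      using some3 ge2 ha hb by (auto simp: internal_rule_def)
  next
    assume o: "outer a \<in> C" "outer b \<notin> C"
    have "a \<in> first_wave" using child o ma by blast
    then show "medial_rule T G C h a b"
      using some3 ge2 ha hb b2 b3 stop(2)[OF _ o(2)] one[OF abC(2) _ o(2)]
      by (auto simp: medial_rule_def)
  next
    assume o: "outer a \<notin> C" "outer b \<notin> C"
    have al: "radical_allowed T G C h a" "radical_allowed T G C h b"
      using recurrent_radical_allowed[OF rec] by blast+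
    let ?S = "radical_stopper T G C h" and ?A = "radical_strongly_allowed T G C h"
    have st: "h a = 3 \<Longrightarrow> ?S a" "h b = 3 \<Longrightarrow> ?S b"
      "h a = 3 \<Longrightarrow> h b = 2 \<Longrightarrow> ?S b" "h b = 3 \<Longrightarrow> h a = 2 \<Longrightarrow> ?S a"
      using stop o a3 b3 a2 b2 by simp_all
    have sa: "h a = 1 \<Longrightarrow> ?A a" "h b = 1 \<Longrightarrow> ?A b"
      using one abC o by blast+
    have "h a = 3 \<or> h b = 3 \<or> h a = 2 \<and> ?A a \<or> h b = 2 \<and> ?A b"
      using two ha hb o by (auto simp: of_bool_def split: if_splits)
    then consider "h a = 3" | "h b = 3" | "h a = 2" "?A a" "h b \<noteq> 3" | "h b = 2" "?A b" "h a \<noteq> 3"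
      by blast
    then show "terminal_rule T G C h a b"
      by cases (use ha hb st sa al in
        \<open>auto simp: terminal_rule_def ordered_terminal_rule_def\<close>)
  qed
qed

text \<open>The burning principle is applied to the union \<open>X\<close> of the cells of
  \<open>C\<close> whose gates are reached from the origin along vertices of height 3. The vertex
  that burns carries the desired liberty.\<close>

lemma necessary_liberty_rule: "liberty_rule T G orig C h"
proof -
  let ?H = "{w \<in> G. h w = 3}"
  define D where "D = component adj ?H orig"
  have D_step: "w \<in> D" if "v \<in> D" "w \<in> G" "h w = 3" "adj v w" for v w
  proof -
    have "v \<in> ?H" using that(1) component_stable[of v adj ?H orig "\<lambda>_. True"] by (simp add: D_def)
    then have "adj_on adj ?H v w" using that by (simp add: adj_on_def)
    then show ?thesis using that(1) unfolding D_def component_def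
      by (auto intro: rtranclp.rtrancl_into_rtrancl)
  qed
  have orig_D: "orig \<in> D" using orig_in_G orig_height by (simp add: D_def component_def)
  have D_sym: "orig \<in> component adj ?H v" if "v \<in> D" for v
  proof -
    have "v \<in> ?H" using that component_stable[of v adj ?H orig "\<lambda>_. True"] by (simp add: D_def)
    moreover have "symp (adj_on adj ?H)" by (auto simp: symp_def adj_on_def intro: adj_sym)
    moreover have "(adj_on adj ?H)\<^sup>*\<^sup>* orig v" using that by (simp add: D_def component_def)
    ultimately show ?thesis using sympD[OF symp_rtranclp, of "adj_on adj ?H" orig v]
      by (simp add: component_def)
  qed
  \<comment> \<open>A path from the origin can get below \<open>s\<close> only over
    \<open>outer (gate s)\<close>.\<close>
  have D_enter: "outer (gate s) \<in> D" if "gate s \<in> D" "s \<noteq> s0" for s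
  proof -
    have "gate s \<in> component adj ?H orig" using that by (simp add: D_def)
    then have "gate s \<in> ?H \<and> gate s \<in> D \<and> (below s (fst (gate s)) \<longrightarrow> outer (gate s) \<in> D)"
    proof (rule component_stable[where P = "\<lambda>v. v \<in> D \<and> (below s (fst v) \<longrightarrow> outer (gate s) \<in> D)"])
      show "orig \<in> D \<and> (below s (fst orig) \<longrightarrow> outer (gate s) \<in> D)"
        using orig_D that(2) by (simp add: below_root)
      fix v w assume vw: "v \<in> ?H" "w \<in> ?H" "adj v w"
        "v \<in> D \<and> (below s (fst v) \<longrightarrow> outer (gate s) \<in> D)"
      have "w \<in> D" using D_step vw by blast
      moreover have "v = outer (gate s)" if "below s (fst w)" "\<not> below s (fst v)"
        using leave_below(2)[of w v s] adj_sym vw(3) that by blast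
      ultimately show "w \<in> D \<and> (below s (fst w) \<longrightarrow> outer (gate s) \<in> D)"
        using vw by blast
    qed
    then show ?thesis by (simp add: below.self)
  qed
  define X where "X = {v \<in> C. gate (fst v) \<in> D}"
  have gate3: "gate s \<in> G \<and> h (gate s) = 3" if "s \<in> fst ` C" for s
    using gate_topples(2)[OF that] gate_in_C that C_subset by blast
  have X_D: "v \<in> D" if "v \<in> X" "h v = 3" for v
  proof (cases "v = gate (fst v)")
    case True
    then show ?thesis using that by (metis (mono_tags, lifting) X_def mem_Collect_eq)
  next
    case False
    have "v \<in> C" "gate (fst v) \<in> D" using that by (auto simp: X_def)
    then have "v \<in> G" "v \<in> cell (fst v)" using C_subset in_G_T by (auto simp: in_cell_iff)
    then show ?thesis
      using D_step[OF \<open>gate (fst v) \<in> D\<close>] adj_same_cell[OF gate_in_cell] False that(2) by metis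
  qed
  \<comment> \<open>If \<open>v\<close> is a gate other than \<open>orig\<close>, the path came over
    \<open>outer v\<close>, which equals or neighbors the gate of its cell. Otherwise
    \<open>outer v\<close> is itself a gate, and gates in \<open>C\<close> have height 3.\<close>
  have X_outer: "outer v \<in> X" if v: "v \<in> X" "h v = 3" "outer v \<in> C" for v
  proof -
    have vT: "T (fst v) (snd v)" using v C_subset in_G_T by (auto simp: X_def)
    have sv: "snd v \<in> fst ` C" using v(3) by (metis fst_outer imageI)
    have "gate (snd v) \<in> D"
    proof (cases "v = gate (fst v) \<and> v \<noteq> orig")
      case True
      then have "fst v \<noteq> s0" using gate_root(1) by metis
      then have "outer v \<in> D" using D_enter X_D[OF v(1,2)] True by metis
      moreover have "outer v \<in> cell (snd v)" using T_sym[OF vT] by (simp add: in_cell_iff)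
      then have "gate (snd v) = outer v \<or> adj (outer v) (gate (snd v))"
        using adj_same_cell gate_in_cell by metis
      ultimately show ?thesis using D_step gate3[OF sv] by metis
    next
      case False
      then have "outer v = gate (snd v)"
        using nongate(2)[OF vT] gate_root(2) by metis
      then show ?thesis using D_step[OF X_D[OF v(1,2)]] gate3[OF sv] adj_outer[OF vT] by metis
    qed
    then show ?thesis using v(3) by (simp add: X_def)
  qed
  have "orig \<in> X" using orig_in_C orig_D by (simp add: X_def)
  moreover have "X \<subseteq> C" by (auto simp: X_def)
  ultimately obtain v where v: "v \<in> X" "card {w \<in> X. adj v w} +
      of_bool (outer v \<notin> C \<and> \<not> radical_strongly_allowed T G C h v) < h v"
    using recurrent_burn[OF rec, of X] by blast
  have vC: "v \<in> C" "gate (fst v) \<in> D" using v(1) by (auto simp: X_def)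
  then have vG: "v \<in> G" "T (fst v) (snd v)" using C_subset in_G_T by auto
  then have "v \<in> cell (fst v)" by (simp add: in_cell_iff)
  then obtain x y where xy: "cell (fst v) = {v, x, y}" "distinct [v, x, y]" by (rule cell_third)
  have "cell (fst v) \<subseteq> X"
    using cell_subset_C[of "fst v"] vC by (auto simp: X_def in_cell_iff)
  then have "x \<in> X" "y \<in> X" using xy by auto
  \<comment> \<open>Both cell mates of \<open>v\<close> lie in \<open>X\<close>, so height 3 is
    forced and nothing further may count: neither an outward neighbor in \<open>X\<close> nor a
    weakly allowed radical.\<close>
  then have "2 + of_bool (outer v \<in> X) +
      of_bool (outer v \<notin> C \<and> \<not> radical_strongly_allowed T G C h v) < h v"
    using v(2) card_neighbors[OF xy, of X] by simp
  moreover have "h v \<le> 3" using h_bounds vG by blast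
  ultimately have "h v = 3" "outer v \<notin> X" "outer v \<in> C \<or> radical_strongly_allowed T G C h v"
    by (auto simp: of_bool_def split: if_splits)
  then have "outer v \<notin> C" "radical_strongly_allowed T G C h v" using X_outer v(1) by blast+
  then show ?thesis
    using vC D_sym[OF X_D[OF v(1) \<open>h v = 3\<close>]] unfolding liberty_rule_def liberty_def by blast
qed

lemma necessary_rules: "extended_filling_rules T G orig C h \<and> liberty_rule T G orig C h"
  using recurrent_radical_allowed[OF rec] necessary_cell_rule necessary_liberty_rule
    toppled_stopper orig_in_C orig_in_first_wave[OF orig_height]
  unfolding extended_filling_rules_iff by blast

end


subsection \<open>Sufficiency of the rules\<close>

context
  assumes rules: "extended_filling_rules T G orig C h" and lib: "liberty_rule T G orig C h"
begin

lemma rule_cell: "s \<in> fst ` C \<Longrightarrow> cell_rule s"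
  and rule_orig: "outer orig \<notin> C \<Longrightarrow> radical_stopper T G C h orig"
  using rules unfolding extended_filling_rules_iff by blast+

text \<open>At the origin, allowedness comes from the stopper condition.\<close>

lemma rule_allowed: "v \<in> C \<Longrightarrow> outer v \<notin> C \<Longrightarrow> radical_allowed T G C h v"
proof (cases "v = orig")
  case True
  moreover assume "outer v \<notin> C"
  ultimately show ?thesis using rule_orig
    by (auto simp: radical_stopper_def stopper_def radical_allowed_def allowed_def has_FSC_def
        forbidden_subconfiguration_def)
qed (use rules extended_filling_rules_iff in blast)

lemma rule_gate: "s \<in> fst ` C \<Longrightarrow> h (gate s) = 3"
  using rule_cell cell_split[of s] unfolding cell_rule_def by metis

lemma cell_rule_cases:
  assumes "s \<in> fst ` C" "cell s = {gate s, a, b}" "distinct [gate s, a, b]"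
  shows "outer a \<in> C \<Longrightarrow> outer b \<in> C \<Longrightarrow> internal_rule h a b"
    "outer a \<in> C \<Longrightarrow> outer b \<notin> C \<Longrightarrow> medial_rule T G C h a b"
    "outer a \<notin> C \<Longrightarrow> outer b \<in> C \<Longrightarrow> medial_rule T G C h b a"
    "outer a \<notin> C \<Longrightarrow> outer b \<notin> C \<Longrightarrow> terminal_rule T G C h a b"
  using rule_cell[OF assms(1)] assms(2,3) cell_swap[OF assms(2,3)]
  unfolding cell_rule_def by blast+

lemma orig_height': "h orig = 3"
  using rule_gate[of s0] orig_in_C by simp

text \<open>By the rules, the vertex facing a child in \<open>C\<close> has height 3, or height 2
  beside a vertex of height 3. It therefore topples after the gate of its cell, and the gate of the
  child, of height 3, follows.\<close>

lemma gate_topples':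
  assumes "s \<in> fst ` C"
  shows "gate s \<in> first_wave"
  using assms
proof (induction s rule: parent_induct)
  case root1
  then show ?case using orig_in_first_wave orig_height' by simp
next
  case root2
  have "outer orig \<in> G" using root2 gate_in_C[of t0] C_subset by auto
  then show ?case
    using wave_step1[OF orig_height' _ _ orig_in_first_wave[OF orig_height']] rule_gate[OF root2]
      adj_sym[OF adj_outer[OF T_orig]] by simp
next
  case (step s)
  let ?p = "parent s" and ?a = "outer (gate s)"
  have p: "?p \<in> fst ` C" using parent_in_C step by blast
  then have gp: "gate ?p \<in> first_wave" using step by blast
  have sT: "T s ?p" by (rule T_parent)
  have "?a \<in> cell ?p" using T_sym[OF sT] by (simp add: in_cell_iff)
  moreover have "?a \<noteq> gate ?p"
  proof
    assume "?a = gate ?p"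
    then have "parent ?p = s" by (metis snd_gate snd_outer fst_gate)
    then show False using mutual_parent[of s ?p] step by auto
  qed
  ultimately obtain b where ab: "cell ?p = {gate ?p, ?a, b}" "distinct [gate ?p, ?a, b]"
    by (rule cell_split_at)
  note sw = cell_swap[OF ab]
  note ma = cell_members[OF ab] and mb = cell_members[OF conjunct1[OF sw] conjunct2[OF sw]]
  have abG: "?a \<in> G" "b \<in> G" using cell_subset_C[OF p] ab C_subset by auto
  have "outer ?a \<in> C" using step gate_in_C by simp
  then have "(h ?a, h b) \<in> {(3, 3), (3, 2), (2, 3), (3, 1)}"
    using cell_rule_cases(1,2)[OF p ab]
    by (cases "outer b \<in> C") (auto simp: internal_rule_def medial_rule_def)
  then have "h ?a = 3 \<or> h ?a \<ge> 2 \<and> h b = 3" by auto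
  then have a: "?a \<in> first_wave"
    using wave_step1[OF orig_height' abG(1) _ gp ma(5)]
      wave_step1[OF orig_height' abG(2) _ gp mb(5)]
      wave_step2[OF orig_height' abG(1) _ gp ma(5) _ ma(6)] mb(4) by metis
  have "gate s \<in> G" using step gate_in_C C_subset by blast
  then show ?case
    using wave_step1[OF orig_height' _ rule_gate[OF step.prems] a] adj_outer[of "gate s"] sT by simp
qed

text \<open>The first vertex outside \<open>C\<close> to topple has at most one neighbor in
  \<open>C\<close>, so it is a radical root of height 3. But the radical at a toppled attachment
  vertex is a stopper.\<close>

lemma wave_stays: "first_wave \<subseteq> C"
proof (rule ccontr)
  assume "\<not> first_wave \<subseteq> C"
  then obtain v where v: "v \<in> first_wave" "v \<notin> C" "h v + card {w \<in> first_wave - (- C). adj v w} > 3"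
    using first_wave_entry[of "- C"] orig_in_C by blast
  have vG: "v \<in> G" using v first_wave_subset by blast
  have in_C: "w = outer v" if "w \<in> C" "adj v w" for w
  proof -
    have "fst w \<noteq> fst v"
      using cell_subset_C[of "fst w"] in_cell_iff[of v T "fst w"] in_G_T[OF vG] v(2) that(1)
      by (metis imageI subsetD)
    then show ?thesis using that(2) by (auto elim: adj_cases)
  qed
  have "{w \<in> first_wave - (- C). adj v w} \<subseteq> {outer v}" using in_C by blast
  from card_mono[OF _ this] have "card {w \<in> first_wave - (- C). adj v w} \<le> 1" by simp
  moreover have hv: "h v \<le> 3" using h_bounds vG by blast
  ultimately have h3: "h v = 3" and "card {w \<in> first_wave - (- C). adj v w} \<noteq> 0"
    using v(3) by linarith+
  then have "{w \<in> first_wave - (- C). adj v w} \<noteq> {}" by (metis card.empty)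
  then obtain b where b: "b \<in> first_wave" "b \<in> C" "adj v b" by blast
  then have bv: "b = outer v" using in_C by blast
  then have bv': "outer b = v" by simp
  have "outer b \<notin> C" using bv' v by simp
  have "radical_stopper T G C h b"
  proof (cases "b = orig")
    case True
    then show ?thesis using rule_orig \<open>outer b \<notin> C\<close> by blast
  next
    case False
    then have ng: "b \<noteq> gate (fst b)" using boundary(2) b \<open>outer b \<notin> C\<close> by blast
    have s: "fst b \<in> fst ` C" using b by blast
    have "b \<in> cell (fst b)" using wave_T[OF b(1)] by (simp add: in_cell_iff)
    then obtain a where ba: "cell (fst b) = {gate (fst b), b, a}" "distinct [gate (fst b), b, a]"
      using ng by (rule cell_split_at)
    \<comment> \<open>Since \<open>b\<close> topples, its height is not 1 and its cell has a
      non-gate vertex of height 3. All rules compatible with this ask for a stopper at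
      \<open>b\<close>.\<close>
    have "h b = 3 \<or> h a = 3" using wave_in_cell_height3[OF ba] b by blast
    moreover have "h b \<ge> 2" using wave_nongate_height b ng by blast
    moreover have "medial_rule T G C h a b \<or> terminal_rule T G C h b a"
      using cell_rule_cases(3,4)[OF s ba] \<open>outer b \<notin> C\<close> by blast
    ultimately show ?thesis
      unfolding medial_rule_def terminal_rule_def ordered_terminal_rule_def by auto
  qed
  moreover have "radical T G C b \<noteq> {}"
    using outer_in_radical_iff[of b] bv' v vG by blast
  ultimately show False using h3 bv' by (simp add: radical_stopper_def stopper_def)
qed

lemma sufficient_wave: "fst ` first_wave = fst ` C"
proof
  show "fst ` first_wave \<subseteq> fst ` C" using wave_stays by blast
  show "fst ` C \<subseteq> fst ` first_wave" using gate_topples' fst_gate by (metis image_eqI subsetI)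
qed

text \<open>Without the gate, \<open>a\<close> and \<open>b\<close> have only each other and their
  outward neighbors in \<open>V\<close>, and roots of strongly allowed radicals are excluded. In
  each case of the rules one of them burns, and then the other.\<close>

lemma FSC_avoids_cell:
  assumes V: "V \<subseteq> G" "\<And>v. v \<in> V \<Longrightarrow> h v \<le> card {w \<in> V. adj v w}"
    and s: "s \<in> fst ` C" "gate s \<notin> V"
  shows "cell s \<inter> V = {}"
proof -
  obtain a b where ab: "cell s = {gate s, a, b}" "distinct [gate s, a, b]" by (rule cell_split)
  have abC: "a \<in> C" "b \<in> C" using cell_subset_C[OF s(1)] ab by auto
  have "cell s = {a, gate s, b}" "distinct [a, gate s, b]"
    "cell s = {b, gate s, a}" "distinct [b, gate s, a]" using ab by auto
  then have a: "a \<in> V \<Longrightarrow> h a \<le> of_bool (b \<in> V) + of_bool (outer a \<in> V)"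
    and b: "b \<in> V \<Longrightarrow> h b \<le> of_bool (a \<in> V) + of_bool (outer b \<in> V)"
    using V(2)[of a] V(2)[of b] card_neighbors[of s a "gate s" b V]
      card_neighbors[of s b "gate s" a V] s(2) by auto
  have strong: "outer v \<notin> V"
    if "v \<in> C" "outer v \<notin> C" "radical_strongly_allowed T G C h v" for v
    using FSC_avoids_strong_radical[OF V that] .
  have "a \<notin> V \<and> b \<notin> V"
  proof (cases "outer a \<in> C"; cases "outer b \<in> C")
    assume o: "outer a \<in> C" "outer b \<in> C"
    show ?thesis using cell_rule_cases(1)[OF s(1) ab o] a b
      by (auto simp: internal_rule_def of_bool_def split: if_splits)
  next
    assume o: "outer a \<in> C" "outer b \<notin> C"
    show ?thesis using cell_rule_cases(2)[OF s(1) ab o] a b strong[OF abC(2) o(2)]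
      by (auto simp: medial_rule_def of_bool_def split: if_splits)
  next
    assume o: "outer a \<notin> C" "outer b \<in> C"
    show ?thesis using cell_rule_cases(3)[OF s(1) ab o] a b strong[OF abC(1) o(1)]
      by (auto simp: medial_rule_def of_bool_def split: if_splits)
  next
    assume o: "outer a \<notin> C" "outer b \<notin> C"
    show ?thesis
      using cell_rule_cases(4)[OF s(1) ab o] a b strong[OF abC(1) o(1)] strong[OF abC(2) o(2)]
      by (auto simp: terminal_rule_def ordered_terminal_rule_def of_bool_def split: if_splits)
  qed
  then show ?thesis using ab s(2) by auto
qed

lemma sufficient_recurrent: "recurrent adj G h"
  unfolding recurrent_def has_FSC_def
proof
  assume "\<exists>V\<subseteq>G. forbidden_subconfiguration adj h V"
  then obtain V where V: "V \<subseteq> G" "V \<noteq> {}" "\<And>v. v \<in> V \<Longrightarrow> h v \<le> card {w \<in> V. adj v w}"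
    unfolding forbidden_subconfiguration_def by blast
  have burn3: "v \<notin> V" if "h v = 3" "adj v w" "w \<notin> V" for v w
    using V(3)[of v] degree_less[of v w V] that by linarith
  obtain v where v: "v \<in> C" "outer v \<notin> C" "orig \<in> component adj {w \<in> G. h w = 3} v"
    "radical_strongly_allowed T G C h v"
    using lib unfolding liberty_rule_def liberty_def by blast
  \<comment> \<open>The root of the strongly allowed liberty is not in \<open>V\<close>; along the
    path of height 3 this carries over to the origin.\<close>
  have "orig \<in> {w \<in> G. h w = 3} \<and> orig \<notin> V"
  proof (rule component_stable[OF v(3)])
    have "h v = 3" "v \<in> G" using v(3) unfolding component_def by auto
    then show "v \<notin> V"
      using burn3 adj_outer[OF in_G_T] FSC_avoids_strong_radical[OF V(1,3) v(1,2,4)] by blast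
    show "w \<notin> V" if "x \<in> {w \<in> G. h w = 3}" "w \<in> {w \<in> G. h w = 3}" "adj x w" "x \<notin> V" for x w
      using burn3 adj_sym that by blast
  qed
  then have orig: "orig \<notin> V" by blast
  \<comment> \<open>From the origin outwards: once a gate is excluded, so is its cell, and with it
    the neighbor of each child gate of height 3.\<close>
  have gates: "gate s \<notin> V" if "s \<in> fst ` C" for s
    using that
  proof (induction s rule: parent_induct)
    case root1
    then show ?case using orig by simp
  next
    case root2
    then show ?case
      using burn3[of "gate t0" orig] rule_gate[OF root2] adj_sym[OF adj_outer[OF T_orig]] orig by simp
  next
    case (step s)
    have p: "parent s \<in> fst ` C" using parent_in_C step by blast
    then have "cell (parent s) \<inter> V = {}" using FSC_avoids_cell[OF V(1,3)] step by blast
    moreover have "outer (gate s) \<in> cell (parent s)"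
      using T_sym[OF T_parent[of s]] by (simp add: in_cell_iff)
    ultimately have "outer (gate s) \<notin> V" by blast
    then show ?case
      using burn3[OF rule_gate[OF step.prems]] adj_outer[of "gate s"] T_parent[of s] by simp
  qed
  have C_V: "v \<notin> V" if "v \<in> C" for v
  proof -
    have "v \<in> cell (fst v)" using that C_subset in_G_T by (auto simp: in_cell_iff)
    then show ?thesis using FSC_avoids_cell[OF V(1,3) _ gates] that by blast
  qed
  \<comment> \<open>What remains of \<open>V\<close> meets a radical whose attachment vertex is
    outside \<open>V\<close>, against allowedness.\<close>
  obtain x where x: "x \<in> V" using V(2) by blast
  then have "x \<in> G" "x \<notin> C" using V(1) C_V by blast+
  then obtain b where "b \<in> C" "outer b \<notin> C" "x \<in> radical T G C b" by (rule G_covered)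
  then show False
    using FSC_avoids_allowed_radical[OF V(1,3)] rule_allowed C_V x by blast
qed

end

lemma wave_iff_rules:
  "(recurrent adj G h \<and>
    {K \<in> cells T G. cell_topples_in_first_wave adj G h orig K} = cells T C) \<longleftrightarrow>
   (extended_filling_rules T G orig C h \<and> liberty_rule T G orig C h)"
  using necessary_rules sufficient_wave sufficient_recurrent wave_cells_iff by blast

end

theorem theorem4:
  fixes T :: "'a \<Rightarrow> 'a \<Rightarrow> bool"
    and G C :: "('a \<times> 'a) set"
    and orig :: "'a \<times> 'a"
    and \<chi> :: "'a \<times> 'a \<Rightarrow> nat"
  assumes "three_regular_tree T"
    and "finite_expanded_cactus T G"
    and "orig \<in> G"
    and "configuration G \<chi>"
    and "cluster T G C"
    and "cell_of T orig \<subseteq> C"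
  shows "(recurrent (cactus_adj T) G \<chi> \<and>
          {K \<in> cells T G. cell_topples_in_first_wave (cactus_adj T) G \<chi> orig K} = cells T C)
     \<longleftrightarrow> (extended_filling_rules T G orig C \<chi> \<and> liberty_rule T G orig C \<chi>)"
proof -
  interpret cactus_cluster T G C orig \<chi>
    using assms by unfold_locales
  show ?thesis by (rule wave_iff_rules)
qed

end
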